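(* Let $R$ be an algebra over a commutative ring $\mathbb K$ and let $\mathcal B=(B,\xi,\zeta,\Delta,\epsilon)$ be a left bialgebroid over $R$. Let $T$ be a left $\mathcal B$-module algebra with action $\triangleright$, and let $X$ be a left $\mathcal B$-comodule with coaction $x\mapsto x_{[-1]}\otimes_Rx_{[0]}$. Regard $T$ as an $R$-ring via the algebra map $\varphi:R\to T$, $r\mapsto\xi(r)\triangleright1_T$. Then $$w:X\otimes_RT\to T\otimes_RX,\qquad x\otimes_Rt\mapsto x_{[-1]}\triangleright t\otimes_Rx_{[0]}$$ is a transposition map for $\varphi$. Hence the cosimplicial $\mathbb K$-module $T^{\widehat\otimes_R\,\ast+1}\widehat\otimes_RX$ admits a para-cocyclic structure $$w_n(t_0\widehat\otimes_R\dots\widehat\otimes_Rt_n\widehat\otimes_Rx)=t_1\widehat\otimes_R\dots\widehat\otimes_Rt_n\widehat\otimes_R(x_{[-1]}\triangleright t_0)\widehat\otimes_Rx_{[0]} .$$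
   Context: All algebras are associative and unital; implicit summation is used in index notations. Left bialgebroid over $R$: data $(B,\xi,\zeta,\Delta,\epsilon)$ with $B$ a $\mathbb K$-algebra, $\xi:R\to B$ and $\zeta:R^{op}\to B$ algebra maps with commuting ranges; $B$ is an $R$-bimodule by $r_1\cdot b\cdot r_2=\xi(r_1)\zeta(r_2)b$; $\Delta:B\to B\otimes_RB$, $b\mapsto b_{(1)}\otimes_Rb_{(2)}$, and $\epsilon:B\to R$ make this bimodule an $R$-coring (a coalgebra in the monoidal category of $R$-bimodules); and (i) $b_{(1)}\zeta(r)\otimes_Rb_{(2)}=b_{(1)}\otimes_Rb_{(2)}\xi(r)$; (ii) $\Delta(1_B)=1_B\otimes_R1_B$, $\Delta(bb')=b_{(1)}b'_{(1)}\otimes_Rb_{(2)}b'_{(2)}$; (iii) $\epsilon(1_B)=1_R$, $\epsilon(bb')=\epsilon(b\,\xi(\epsilon(b')))$. A left $\mathcal B$-module $V$ is an $R$-bimodule by $r_1\cdot v\cdot r_2=\xi(r_1)\zeta(r_2)\triangleright v$. A left $\mathcal B$-module algebra is a $\mathbb K$-algebra and left $\mathcal B$-module $T$ whose multiplication is $R$-balanced and such that $b\triangleright1_T=\xi(\epsilon(b))\triangleright1_T$ and $b\triangleright(tt')=(b_{(1)}\triangleright t)(b_{(2)}\triangleright t')$. A left $\mathcal B$-comodule is a left $R$-module $X$ with a left $R$-linear, coassociative and counital coaction $X\to\mathcal B\otimes_RX$, $x\mapsto x_{[-1]}\otimes_Rx_{[0]}$; it is an $R$-bimodule with right action $x\cdot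 r:=\epsilon(x_{[-1]}\xi(r))\cdot x_{[0]}$. Transposition map: for an algebra map $\varphi:R\to T$ with multiplication $m_T:T\otimes_RT\to T$ and an $R$-bimodule $X$, it is an $R$-bimodule map $w:X\otimes_RT\to T\otimes_RX$ with $w\circ(X\otimes_R\varphi)=\varphi\otimes_RX$ (identifying $X\otimes_RR\cong X\cong R\otimes_RX$) and $w\circ(X\otimes_Rm_T)=(m_T\otimes_RX)\circ(T\otimes_Rw)\circ(w\otimes_RT)$. Cyclic tensor product: for $R$-bimodules, $X_1\widehat\otimes_R\dots\widehat\otimes_RX_n$ is the quotient $\mathbb K$-module of $Y=X_1\otimes_R\dots\otimes_RX_n$ by the submodule generated by $r\cdot y-y\cdot r$, $r\in R$, $y\in Y$; the class of $x_1\otimes_R\dots\otimes_R x_n$ is $x_1\widehat\otimes_R\dots\widehat\otimes_Rx_n$. The cosimplicial $\mathbb K$-module $Z^n=T^{\widehat\otimes_R\,n+1}\widehat\otimes_RX$ has cofaces $d_k:Z^{n-1}\to Z^n$ and codegeneracies $s_k:Z^{n+1}\to Z^n$ ($0\le k\le n$): $d_k$ inserts $1_T$ between $t_{k-1}$ and $t_k$ (for $k=0$ in front of $t_0$, for $k=n$ between $t_{n-1}$ and $x$), and $s_k$ replaces $t_k\widehat\otimes_Rt_{k+1}$ by the product $t_kt_{k+1}$. A para-cocyclic structure on a cosimplicial object consists of morphisms $w_n:Z^n\to Z^n$ with $w_nd_0=d_n$, $w_nd_k=d_{k-1}w_{n-1}$, $w_ns_0=s_n(w_{n+1})^2$, $w_ns_k=s_{k-1}w_{n+1}$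 for $1\le k\le n$ (relations with cofaces for $n\ge1$). *)

theory Defs
  imports
    "HOL-Library.Poly_Mapping"
    "HOL-Library.Set_Algebras"
    "HOL-Computational_Algebra.Group_Closure"
begin

section \<open>Rings, modules and algebras\<close>

text \<open>
  Rings have sort \<open>{ring, monoid_mult}\<close> instead of \<open>ring_1\<close>, because \<open>ring_1\<close> excludes the
  zero ring.
\<close>

locale left_module =
  fixes act :: "'r::{ring,monoid_mult} \<Rightarrow> 'm::ab_group_add \<Rightarrow> 'm"
  assumes act_add_right: "act r (x + y) = act r x + act r y"
    and act_add_left: "act (r + s) x = act r x + act s x"
    and act_act: "act r (act s x) = act (r * s) x"
    and act_one: "act 1 x = x"

locale k_algebra = left_module scale
  for scale :: "'k::{comm_ring,comm_monoid_mult} \<Rightarrow> 'a::{ring,monoid_mult} \<Rightarrow> 'a" +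
  assumes scale_mult_left: "scale k a * b = scale k (a * b)"
    and scale_mult_right: "a * scale k b = scale k (a * b)"

locale k_algebra_map = A: k_algebra scale_A + B: k_algebra scale_B
  for scale_A :: "'k::{comm_ring,comm_monoid_mult} \<Rightarrow> 'a::{ring,monoid_mult} \<Rightarrow> 'a"
    and scale_B :: "'k \<Rightarrow> 'b::{ring,monoid_mult} \<Rightarrow> 'b" +
  fixes f :: "'a \<Rightarrow> 'b"
  assumes map_add: "f (a + a') = f a + f a'"
    and map_scale: "f (scale_A k a) = scale_B k (f a)"
    and map_mult: "f (a * a') = f a * f a'"
    and map_one: "f 1 = 1"

text \<open>
  Here \<open>rX r x\<close> stands for \<open>x \<cdot> r\<close>.  A one-sided module over a \<open>\<bbbK>\<close>-algebra \<open>R\<close> is a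
  \<open>\<bbbK>\<close>-module through \<open>k x = (k 1) \<cdot> x\<close>; a bimodule has the same \<open>\<bbbK>\<close>-module structure from
  both sides.  In particular \<open>R\<close>-linear maps are \<open>\<bbbK>\<close>-linear.
\<close>

locale bimodule = k_algebra scale_R + left_module lX
  for scale_R :: "'k::{comm_ring,comm_monoid_mult} \<Rightarrow> 'r::{ring,monoid_mult} \<Rightarrow> 'r"
    and lX :: "'r \<Rightarrow> 'x::ab_group_add \<Rightarrow> 'x" +
  fixes rX :: "'r \<Rightarrow> 'x \<Rightarrow> 'x"
  assumes right_add_right: "rX r (x + y) = rX r x + rX r y"
    and right_add_left: "rX (r + s) x = rX r x + rX s x"
    and right_right: "rX s (rX r x) = rX (r * s) x"
    and right_one: "rX 1 x = x"
    and left_right: "lX r (rX s x) = rX s (lX r x)"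
    and central: "lX (scale_R k 1) x = rX (scale_R k 1) x"

section \<open>Quotients of free abelian groups\<close>

text \<open>
  Tensor products are quotients of the free abelian group \<open>'a \<Rightarrow>\<^sub>0 int\<close> on tuples by a subgroup
  \<open>N\<close>.  Their elements are the cosets of \<open>N\<close>; the sum of two cosets is the sum of sets.
\<close>

definition quot :: "'a set \<Rightarrow> ('a \<Rightarrow>\<^sub>0 int) set \<Rightarrow> ('a \<Rightarrow>\<^sub>0 int) set set"
  where "quot A N = {p +o N | p. Poly_Mapping.keys p \<subseteq> A}"

definition pure :: "('a \<Rightarrow>\<^sub>0 int) set \<Rightarrow> 'a \<Rightarrow> ('a \<Rightarrow>\<^sub>0 int) set"
  where "pure N a = frag_of a +o N"

text \<open>
  \<open>induced N f c\<close> is the value at the coset \<open>c\<close> of the additive map that sends the class of a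
  generator \<open>a\<close> to the coset \<open>f a\<close> of \<open>N\<close>.  It is the union of the values computed from all
  representatives of \<open>c\<close> and of the cosets \<open>f a\<close>; so it is again a coset of \<open>N\<close> exactly if the
  value does not depend on representatives.  If \<open>c\<close> is the coaction \<open>x\<^bsub>[-1]\<^esub> \<otimes> x\<^bsub>[0]\<^esub>\<close>, then
  \<open>induced N (\<lambda>(b, y). f b y) c\<close> is what Sweedler notation writes as \<open>f x\<^bsub>[-1]\<^esub> x\<^bsub>[0]\<^esub>\<close>.
\<close>

definition induced ::
    "('b \<Rightarrow>\<^sub>0 int) set \<Rightarrow> ('a \<Rightarrow> ('b \<Rightarrow>\<^sub>0 int) set) \<Rightarrow> ('a \<Rightarrow>\<^sub>0 int) set \<Rightarrow> ('b \<Rightarrow>\<^sub>0 int) set"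
  where "induced N f c =
    (\<Union>p\<in>c. \<Union>g\<in>{g. \<forall>a\<in>Poly_Mapping.keys p. g a \<in> f a}. frag_extend g p +o N)"

text \<open>The same for maps into an abelian group that is given as a type.\<close>

definition int_mult :: "int \<Rightarrow> 'm::ab_group_add \<Rightarrow> 'm"
  where "int_mult z x = (\<Sum>i<nat z. x) - (\<Sum>i<nat (- z). x)"

definition induced_val :: "('a \<Rightarrow> 'm::ab_group_add) \<Rightarrow> ('a \<Rightarrow>\<^sub>0 int) set \<Rightarrow> 'm"
  where "induced_val f c =
    the_elem ((\<lambda>p. \<Sum>a\<in>Poly_Mapping.keys p. int_mult (Poly_Mapping.lookup p a) (f a)) ` c)"

section \<open>Tensor products over a noncommutative ring\<close>

text \<open>
  \<open>tens2 rA lB\<close> is the subgroup of relations of \<open>A \<otimes>\<^sub>R B\<close>, for the right action \<open>rA\<close> on \<open>A\<close>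
  and the left action \<open>lB\<close> on \<open>B\<close>; similarly for threefold tensor products, which are taken
  without brackets.  If \<open>A\<close> and \<open>B\<close> are \<open>\<bbbK>\<close>-modules via \<open>R\<close>, then \<open>\<bbbK>\<close>-balancedness is part
  of \<open>R\<close>-balancedness.
\<close>

definition tens2 ::
    "('r \<Rightarrow> 'a::ab_group_add \<Rightarrow> 'a) \<Rightarrow> ('r \<Rightarrow> 'b::ab_group_add \<Rightarrow> 'b) \<Rightarrow> ('a \<times> 'b \<Rightarrow>\<^sub>0 int) set"
  where "tens2 rA lB = group_closure (
      {frag_of (a + a', b) - frag_of (a, b) - frag_of (a', b) | a a' b. True}
    \<union> {frag_of (a, b + b') - frag_of (a, b) - frag_of (a, b') | a b b'. True}
    \<union> {frag_of (rA r a, b) - frag_of (a, lB r b) | r a b. True})"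

definition tens3 ::
    "('r \<Rightarrow> 'a::ab_group_add \<Rightarrow> 'a) \<Rightarrow> ('r \<Rightarrow> 'b::ab_group_add \<Rightarrow> 'b) \<Rightarrow> ('r \<Rightarrow> 'b \<Rightarrow> 'b) \<Rightarrow>
     ('r \<Rightarrow> 'c::ab_group_add \<Rightarrow> 'c) \<Rightarrow> ('a \<times> 'b \<times> 'c \<Rightarrow>\<^sub>0 int) set"
  where "tens3 rA lB rB lC = group_closure (
      {frag_of (a + a', b, c) - frag_of (a, b, c) - frag_of (a', b, c) | a a' b c. True}
    \<union> {frag_of (a, b + b', c) - frag_of (a, b, c) - frag_of (a, b', c) | a b b' c. True}
    \<union> {frag_of (a, b, c + c') - frag_of (a, b, c) - frag_of (a, b, c') | a b c c'. True}
    \<union> {frag_of (rA r a, b, c) - frag_of (a, lB r b, c) | r a b c. True}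
    \<union> {frag_of (a, rB r b, c) - frag_of (a, b, lC r c) | r a b c. True})"

section \<open>Left bialgebroids, module algebras and comodules\<close>

locale left_bialgebroid = k_algebra_map scale_R scale_B xi
  for scale_R :: "'k::{comm_ring,comm_monoid_mult} \<Rightarrow> 'r::{ring,monoid_mult} \<Rightarrow> 'r"
    and scale_B :: "'k \<Rightarrow> 'b::{ring,monoid_mult} \<Rightarrow> 'b"
    and xi :: "'r \<Rightarrow> 'b" +
  fixes zeta :: "'r \<Rightarrow> 'b"
    and Delta :: "'b \<Rightarrow> ('b \<times> 'b \<Rightarrow>\<^sub>0 int) set"
    and eps :: "'b \<Rightarrow> 'r"
  fixes lB rB BB BBB
  defines "lB \<equiv> \<lambda>r b. xi r * b"
    and "rB \<equiv> \<lambda>r b. zeta r * b"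
    and "BB \<equiv> tens2 rB lB"
    and "BBB \<equiv> tens3 rB lB rB lB"
  assumes zeta_add: "zeta (r + s) = zeta r + zeta s"
    and zeta_scale: "zeta (scale_R k r) = scale_B k (zeta r)"
    and zeta_mult: "zeta (r * s) = zeta s * zeta r"
    and zeta_one: "zeta 1 = 1"
    and xi_zeta_commute: "xi r * zeta s = zeta s * xi r"
    and Delta_closed: "Delta b \<in> quot UNIV BB"
    and Delta_add: "Delta (b + b') = Delta b + Delta b'"
    and Delta_left: "Delta (lB r b) = induced BB (\<lambda>(b1, b2). pure BB (lB r b1, b2)) (Delta b)"
    and Delta_right: "Delta (rB r b) = induced BB (\<lambda>(b1, b2). pure BB (b1, rB r b2)) (Delta b)"
    and eps_add: "eps (b + b') = eps b + eps b'"
    and eps_left: "eps (lB r b) = r * eps b"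
    and eps_right: "eps (rB r b) = eps b * r"
    and coassociative:
      "induced BBB (\<lambda>(b1, b2). induced BBB (\<lambda>(b11, b12). pure BBB (b11, b12, b2)) (Delta b1)) (Delta b) =
       induced BBB (\<lambda>(b1, b2). induced BBB (\<lambda>(b21, b22). pure BBB (b1, b21, b22)) (Delta b2)) (Delta b)"
    and counit_left: "induced_val (\<lambda>(b1, b2). lB (eps b1) b2) (Delta b) = b"
    and counit_right: "induced_val (\<lambda>(b1, b2). rB (eps b2) b1) (Delta b) = b"
    and takeuchi:
      "induced BB (\<lambda>(b1, b2). pure BB (b1 * zeta r, b2)) (Delta b) =
       induced BB (\<lambda>(b1, b2). pure BB (b1, b2 * xi r)) (Delta b)"
    and Delta_one: "Delta 1 = pure BB (1, 1)"
    \<comment> \<open>The order of the two Sweedler expansions matters: right multiplication by \<open>b1' \<otimes> b2'\<close>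
      is well defined on \<open>B \<otimes>\<^sub>R B\<close>, and its value at \<open>Delta b\<close> is \<open>R\<close>-balanced in
      \<open>(b1', b2')\<close> by the condition \<open>takeuchi\<close>; left multiplication by \<open>b1 \<otimes> b2\<close> need not be well
      defined.\<close>
    and Delta_mult:
      "Delta (b * b') =
       induced BB (\<lambda>(b1', b2'). induced BB (\<lambda>(b1, b2). pure BB (b1 * b1', b2 * b2')) (Delta b)) (Delta b')"
    and eps_one: "eps 1 = 1"
    and eps_mult: "eps (b * b') = eps (b * xi (eps b'))"

locale left_module_algebra =
  left_bialgebroid scale_R scale_B xi zeta Delta eps + T: k_algebra scale_T + Tmod: left_module act
  for scale_R :: "'k::{comm_ring,comm_monoid_mult} \<Rightarrow> 'r::{ring,monoid_mult} \<Rightarrow> 'r"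
    and scale_B :: "'k \<Rightarrow> 'b::{ring,monoid_mult} \<Rightarrow> 'b"
    and xi zeta Delta eps
    and scale_T :: "'k \<Rightarrow> 't::{ring,monoid_mult} \<Rightarrow> 't"
    and act :: "'b \<Rightarrow> 't \<Rightarrow> 't" +
  assumes act_scale_left: "act (scale_B k b) t = scale_T k (act b t)"
    and act_scale_right: "act b (scale_T k t) = scale_T k (act b t)"
    and mult_balanced: "act (zeta r) t * t' = t * act (xi r) t'"
    and act_unit: "act b 1 = act (xi (eps b)) 1"
    and act_mult: "act b (t * t') = induced_val (\<lambda>(b1, b2). act b1 t * act b2 t') (Delta b)"

locale left_comodule =
  left_bialgebroid scale_R scale_B xi zeta Delta eps + X: left_module lX
  for scale_R :: "'k::{comm_ring,comm_monoid_mult} \<Rightarrow> 'r::{ring,monoid_mult} \<Rightarrow> 'r"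
    and scale_B :: "'k \<Rightarrow> 'b::{ring,monoid_mult} \<Rightarrow> 'b"
    and xi zeta Delta eps
    and lX :: "'r \<Rightarrow> 'x::ab_group_add \<Rightarrow> 'x" +
  fixes rho :: "'x \<Rightarrow> ('b \<times> 'x \<Rightarrow>\<^sub>0 int) set"
  fixes BX BBX
  defines "BX \<equiv> tens2 rB lX"
    and "BBX \<equiv> tens3 rB lB rB lX"
  assumes rho_closed: "rho x \<in> quot UNIV BX"
    and rho_add: "rho (x + y) = rho x + rho y"
    and rho_left: "rho (lX r x) = induced BX (\<lambda>(b, y). pure BX (lB r b, y)) (rho x)"
    and rho_coassociative:
      "induced BBX (\<lambda>(b, y). induced BBX (\<lambda>(b1, b2). pure BBX (b1, b2, y)) (Delta b)) (rho x) =
       induced BBX (\<lambda>(b, y). induced BBX (\<lambda>(b', y'). pure BBX (b, b', y')) (rho y)) (rho x)"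
    and rho_counit: "induced_val (\<lambda>(b, y). lX (eps b) y) (rho x) = x"

definition comodule_right ::
    "('r \<Rightarrow> 'b) \<Rightarrow> ('b::times \<Rightarrow> 'r) \<Rightarrow> ('r \<Rightarrow> 'x::ab_group_add \<Rightarrow> 'x) \<Rightarrow>
     ('x \<Rightarrow> ('b \<times> 'x \<Rightarrow>\<^sub>0 int) set) \<Rightarrow> 'r \<Rightarrow> 'x \<Rightarrow> 'x"
  where "comodule_right xi eps lX rho r x = induced_val (\<lambda>(b, y). lX (eps (b * xi r)) y) (rho x)"

section \<open>Transposition maps\<close>

text \<open>\<open>T\<close> is an \<open>R\<close>-bimodule through the algebra map \<open>phi\<close>.\<close>

locale transposition_map =
  k_algebra_map scale_R scale_T phi + X: bimodule scale_R lX rX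
  for scale_R :: "'k::{comm_ring,comm_monoid_mult} \<Rightarrow> 'r::{ring,monoid_mult} \<Rightarrow> 'r"
    and scale_T :: "'k \<Rightarrow> 't::{ring,monoid_mult} \<Rightarrow> 't"
    and phi :: "'r \<Rightarrow> 't"
    and lX :: "'r \<Rightarrow> 'x::ab_group_add \<Rightarrow> 'x"
    and rX :: "'r \<Rightarrow> 'x \<Rightarrow> 'x" +
  fixes w :: "('x \<times> 't \<Rightarrow>\<^sub>0 int) set \<Rightarrow> ('t \<times> 'x \<Rightarrow>\<^sub>0 int) set"
  fixes lT rT XT TX XR RX XTT TXT TTX
  defines "lT \<equiv> \<lambda>r t. phi r * t"
    and "rT \<equiv> \<lambda>r t. t * phi r"
    and "XT \<equiv> tens2 rX lT"
    and "TX \<equiv> tens2 rT lX"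
    and "XR \<equiv> tens2 rX (*)"
    and "RX \<equiv> tens2 (\<lambda>r s. s * r) lX"
    and "XTT \<equiv> tens3 rX lT rT lT"
    and "TXT \<equiv> tens3 rT lX rX lT"
    and "TTX \<equiv> tens3 rT lT rT lX"
  assumes w_closed: "c \<in> quot UNIV XT \<Longrightarrow> w c \<in> quot UNIV TX"
    and w_add: "\<lbrakk>c \<in> quot UNIV XT; c' \<in> quot UNIV XT\<rbrakk> \<Longrightarrow> w (c + c') = w c + w c'"
    and w_left: "c \<in> quot UNIV XT \<Longrightarrow>
      w (induced XT (\<lambda>(x, t). pure XT (lX r x, t)) c) =
      induced TX (\<lambda>(t, x). pure TX (lT r t, x)) (w c)"
    and w_right: "c \<in> quot UNIV XT \<Longrightarrow>
      w (induced XT (\<lambda>(x, t). pure XT (x, rT r t)) c) =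
      induced TX (\<lambda>(t, x). pure TX (t, rX r x)) (w c)"
    \<comment> \<open>the innermost map on the right is the identification \<open>X \<otimes>\<^sub>R R \<cong> X \<cong> R \<otimes>\<^sub>R X\<close>\<close>
    and w_unit: "u \<in> quot UNIV XR \<Longrightarrow>
      w (induced XT (\<lambda>(x, r). pure XT (x, phi r)) u) =
      induced TX (\<lambda>(r, x). pure TX (phi r, x)) (induced RX (\<lambda>(x, r). pure RX (1, rX r x)) u)"
    and w_mult: "v \<in> quot UNIV XTT \<Longrightarrow>
      w (induced XT (\<lambda>(x, t, t'). pure XT (x, t * t')) v) =
      induced TX (\<lambda>(t, t', x). pure TX (t * t', x))
        (induced TTX (\<lambda>(t, x, t'). induced TTX (\<lambda>(t'', y). pure TTX (t, t'', y)) (w (pure XT (x, t'))))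
          (induced TXT (\<lambda>(x, t, t'). induced TXT (\<lambda>(t'', y). pure TXT (t'', y, t')) (w (pure XT (x, t)))) v))"

section \<open>Para-cocyclic modules\<close>

locale module_on =
  fixes Z :: "'m::ab_semigroup_add set"
    and sc :: "'k::{comm_ring,comm_monoid_mult} \<Rightarrow> 'm \<Rightarrow> 'm"
  assumes add_closed: "\<lbrakk>c \<in> Z; c' \<in> Z\<rbrakk> \<Longrightarrow> c + c' \<in> Z"
    and group: "\<exists>z\<in>Z. \<forall>c\<in>Z. z + c = c \<and> (\<exists>c'\<in>Z. c + c' = z)"
    and sc_closed: "c \<in> Z \<Longrightarrow> sc k c \<in> Z"
    and sc_add_right: "\<lbrakk>c \<in> Z; c' \<in> Z\<rbrakk> \<Longrightarrow> sc k (c + c') = sc k c + sc k c'"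
    and sc_add_left: "c \<in> Z \<Longrightarrow> sc (k + l) c = sc k c + sc l c"
    and sc_sc: "c \<in> Z \<Longrightarrow> sc k (sc l c) = sc (k * l) c"
    and sc_one: "c \<in> Z \<Longrightarrow> sc 1 c = c"

definition linear_on ::
    "'m::plus set \<Rightarrow> ('k \<Rightarrow> 'm \<Rightarrow> 'm) \<Rightarrow> 'n::plus set \<Rightarrow> ('k \<Rightarrow> 'n \<Rightarrow> 'n) \<Rightarrow> ('m \<Rightarrow> 'n) \<Rightarrow> bool"
  where "linear_on Z sc Z' sc' f \<longleftrightarrow>
    (\<forall>c\<in>Z. f c \<in> Z') \<and> (\<forall>c\<in>Z. \<forall>c'\<in>Z. f (c + c') = f c + f c') \<and>
    (\<forall>k. \<forall>c\<in>Z. f (sc k c) = sc' k (f c))"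

text \<open>
  Indexing: \<open>d n k\<close> is the coface \<open>d\<^sub>k : Z\<^sup>n \<rightarrow> Z\<^sup>n\<^sup>+\<^sup>1\<close> for \<open>k \<le> n + 1\<close>, and \<open>s n k\<close> is the
  codegeneracy \<open>s\<^sub>k : Z\<^sup>n\<^sup>+\<^sup>1 \<rightarrow> Z\<^sup>n\<close> for \<open>k \<le> n\<close>.
\<close>

locale cosimplicial_module =
  fixes Z :: "nat \<Rightarrow> 'm::ab_semigroup_add set"
    and sc :: "nat \<Rightarrow> 'k::{comm_ring,comm_monoid_mult} \<Rightarrow> 'm \<Rightarrow> 'm"
    and d :: "nat \<Rightarrow> nat \<Rightarrow> 'm \<Rightarrow> 'm"
    and s :: "nat \<Rightarrow> nat \<Rightarrow> 'm \<Rightarrow> 'm"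
  assumes Z_module: "module_on (Z n) (sc n)"
    and d_linear: "k \<le> Suc n \<Longrightarrow> linear_on (Z n) (sc n) (Z (Suc n)) (sc (Suc n)) (d n k)"
    and s_linear: "k \<le> n \<Longrightarrow> linear_on (Z (Suc n)) (sc (Suc n)) (Z n) (sc n) (s n k)"
    and d_d: "\<lbrakk>i < j; j \<le> Suc (Suc n); c \<in> Z n\<rbrakk> \<Longrightarrow>
      d (Suc n) j (d n i c) = d (Suc n) i (d n (j - 1) c)"
    and s_s: "\<lbrakk>i \<le> j; j \<le> n; c \<in> Z (Suc (Suc n))\<rbrakk> \<Longrightarrow>
      s n j (s (Suc n) i c) = s n i (s (Suc n) (Suc j) c)"
    and s_d_less: "\<lbrakk>i < j; j \<le> Suc n; c \<in> Z (Suc n)\<rbrakk> \<Longrightarrow>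
      s (Suc n) j (d (Suc n) i c) = d n i (s n (j - 1) c)"
    and s_d_eq: "\<lbrakk>i = j \<or> i = Suc j; j \<le> n; c \<in> Z n\<rbrakk> \<Longrightarrow> s n j (d n i c) = c"
    and s_d_greater: "\<lbrakk>Suc j < i; i \<le> Suc (Suc n); c \<in> Z (Suc n)\<rbrakk> \<Longrightarrow>
      s (Suc n) j (d (Suc n) i c) = d n (i - 1) (s n j c)"

locale para_cocyclic_module = cosimplicial_module Z sc d s
  for Z :: "nat \<Rightarrow> 'm::ab_semigroup_add set"
    and sc :: "nat \<Rightarrow> 'k::{comm_ring,comm_monoid_mult} \<Rightarrow> 'm \<Rightarrow> 'm"
    and d s +
  fixes w :: "nat \<Rightarrow> 'm \<Rightarrow> 'm"
  assumes w_linear: "linear_on (Z n) (sc n) (Z n) (sc n) (w n)"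
    and w_d_zero: "c \<in> Z n \<Longrightarrow> w (Suc n) (d n 0 c) = d n (Suc n) c"
    and w_d: "\<lbrakk>1 \<le> k; k \<le> Suc n; c \<in> Z n\<rbrakk> \<Longrightarrow> w (Suc n) (d n k c) = d n (k - 1) (w n c)"
    and w_s_zero: "c \<in> Z (Suc n) \<Longrightarrow> w n (s n 0 c) = s n n (w (Suc n) (w (Suc n) c))"
    and w_s: "\<lbrakk>1 \<le> k; k \<le> n; c \<in> Z (Suc n)\<rbrakk> \<Longrightarrow> w n (s n k c) = s n (k - 1) (w (Suc n) c)"

section \<open>The cyclic tensor powers of an \<open>R\<close>-ring with coefficients\<close>

text \<open>
  A generator \<open>t\<^sub>0 \<otimes> \<dots> \<otimes> t\<^sub>n \<otimes> x\<close> is encoded by the pair \<open>(ts, x)\<close> with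
  \<open>ts = [t\<^sub>0, \<dots>, t\<^sub>n]\<close>.  The relations of \<open>Y = T \<otimes>\<^sub>R \<dots> \<otimes>\<^sub>R T \<otimes>\<^sub>R X\<close> are
  \<open>tens_pow_rel\<close>; the cyclic tensor product divides further by all \<open>r \<cdot> y - y \<cdot> r\<close>, so its
  elements are the cosets of \<open>cyc_rel\<close>.  The subgroup generated by the elements
  \<open>r \<cdot> y - y \<cdot> r\<close> is a \<open>\<bbbK>\<close>-submodule, because \<open>k (r \<cdot> y - y \<cdot> r) = r \<cdot> k y - k y \<cdot> r\<close>.
\<close>

definition tuples :: "nat \<Rightarrow> ('t list \<times> 'x) set"
  where "tuples n = {(ts, x). length ts = Suc n}"

definition tens_pow_rel ::
    "('r \<Rightarrow> 't::{ring,monoid_mult}) \<Rightarrow> ('r \<Rightarrow> 'x::ab_group_add \<Rightarrow> 'x) \<Rightarrow> nat \<Rightarrow>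
     ('t list \<times> 'x \<Rightarrow>\<^sub>0 int) set"
  where "tens_pow_rel phi lX n = group_closure (
      {frag_of (ts[i := a + b], x) - frag_of (ts[i := a], x) - frag_of (ts[i := b], x)
        | ts i a b x. length ts = Suc n \<and> i \<le> n}
    \<union> {frag_of (ts, x + y) - frag_of (ts, x) - frag_of (ts, y) | ts x y. length ts = Suc n}
    \<union> {frag_of (ts[i := ts ! i * phi r], x) - frag_of (ts[Suc i := phi r * ts ! Suc i], x)
        | ts i r x. length ts = Suc n \<and> i < n}
    \<union> {frag_of (ts[n := ts ! n * phi r], x) - frag_of (ts, lX r x) | ts r x. length ts = Suc n})"

definition cyc_rel ::
    "('r \<Rightarrow> 't::{ring,monoid_mult}) \<Rightarrow> ('r \<Rightarrow> 'x::ab_group_add \<Rightarrow> 'x) \<Rightarrow> ('r \<Rightarrow> 'x \<Rightarrow> 'x) \<Rightarrow> nat \<Rightarrow>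
     ('t list \<times> 'x \<Rightarrow>\<^sub>0 int) set"
  where "cyc_rel phi lX rX n = group_closure (tens_pow_rel phi lX n \<union>
    {frag_extend (\<lambda>(ts, x). frag_of (ts[0 := phi r * ts ! 0], x)) y
     - frag_extend (\<lambda>(ts, x). frag_of (ts, rX r x)) y | r y. Poly_Mapping.keys y \<subseteq> tuples n})"

definition cyc_carrier ::
    "('r \<Rightarrow> 't::{ring,monoid_mult}) \<Rightarrow> ('r \<Rightarrow> 'x::ab_group_add \<Rightarrow> 'x) \<Rightarrow> ('r \<Rightarrow> 'x \<Rightarrow> 'x) \<Rightarrow> nat \<Rightarrow>
     ('t list \<times> 'x \<Rightarrow>\<^sub>0 int) set set"
  where "cyc_carrier phi lX rX n = quot (tuples n) (cyc_rel phi lX rX n)"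

definition cyc_scale ::
    "('k \<Rightarrow> 't \<Rightarrow> 't) \<Rightarrow> ('r \<Rightarrow> 't::{ring,monoid_mult}) \<Rightarrow> ('r \<Rightarrow> 'x::ab_group_add \<Rightarrow> 'x) \<Rightarrow>
     ('r \<Rightarrow> 'x \<Rightarrow> 'x) \<Rightarrow> nat \<Rightarrow> 'k \<Rightarrow> ('t list \<times> 'x \<Rightarrow>\<^sub>0 int) set \<Rightarrow> ('t list \<times> 'x \<Rightarrow>\<^sub>0 int) set"
  where "cyc_scale scale_T phi lX rX n k =
    induced (cyc_rel phi lX rX n)
      (\<lambda>(ts, x). pure (cyc_rel phi lX rX n) (ts[0 := scale_T k (ts ! 0)], x))"

definition cyc_coface ::
    "('r \<Rightarrow> 't::{ring,monoid_mult}) \<Rightarrow> ('r \<Rightarrow> 'x::ab_group_add \<Rightarrow> 'x) \<Rightarrow> ('r \<Rightarrow> 'x \<Rightarrow> 'x) \<Rightarrow>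
     nat \<Rightarrow> nat \<Rightarrow> ('t list \<times> 'x \<Rightarrow>\<^sub>0 int) set \<Rightarrow> ('t list \<times> 'x \<Rightarrow>\<^sub>0 int) set"
  where "cyc_coface phi lX rX n k =
    induced (cyc_rel phi lX rX (Suc n))
      (\<lambda>(ts, x). pure (cyc_rel phi lX rX (Suc n)) (take k ts @ 1 # drop k ts, x))"

definition cyc_codegeneracy ::
    "('r \<Rightarrow> 't::{ring,monoid_mult}) \<Rightarrow> ('r \<Rightarrow> 'x::ab_group_add \<Rightarrow> 'x) \<Rightarrow> ('r \<Rightarrow> 'x \<Rightarrow> 'x) \<Rightarrow>
     nat \<Rightarrow> nat \<Rightarrow> ('t list \<times> 'x \<Rightarrow>\<^sub>0 int) set \<Rightarrow> ('t list \<times> 'x \<Rightarrow>\<^sub>0 int) set"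
  where "cyc_codegeneracy phi lX rX n k =
    induced (cyc_rel phi lX rX n)
      (\<lambda>(ts, x). pure (cyc_rel phi lX rX n)
        (take k ts @ (ts ! k * ts ! Suc k) # drop (Suc (Suc k)) ts, x))"

end

(*
  Elements of tensor products are handled through representatives in free abelian groups: a map
  with formula f on generators is frag_extend f, and nested Sweedler expressions become nested
  frag_extend's, which compose without any side condition.  Well-definedness (descends) is needed
  only when a relation is carried through a map.

  A comodule satisfies rho (x r) = x_[-1] xi(r) (x) x_[0] and
  x_[-1] (x) x_[0] r = x_[-1] zeta(r) (x) x_[0].  In a module algebra xi(r) and zeta(r) act as
  left and right multiplication by phi(r).  Together these show that w is R-balanced and right
  R-linear; compatibility with the multiplication of T is coassociativity of rho, and
  compatibility with the unit is its counit axiom.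

  For the para-cocyclic structure only the transposition axioms are used.  The one relation of
  the cyclic tensor product that does not follow factorwise is t_0 phi(r) (x) t_1 ~ t_0 (x) phi(r) t_1:
  applying w to t_0 phi(r) leaves r on the right of x, and the cyclic relation carries it around
  to t_1.
*)

theory Submission
  imports Defs
begin

section \<open>Cosets and additive maps of free abelian groups\<close>

text \<open>Neither \<open>Delta\<close> nor \<open>rho\<close> has canonical representatives. The
  chosen ones, \<open>D b\<close>, \<open>P x\<close> and hence \<open>W x t\<close>, are additive
  and linear only modulo the relation subgroups, so every law about them is an equation between
  cosets. Replacing the summands of a formal sum by congruent ones is always allowed
  (\<open>frag_extend_coset_cong\<close>); applying a further map to two congruent sums requires
  that this map descends (\<open>descends_coset\<close>). This asymmetry decides where
  well-definedness has to be proved. In a nested expression the inner map is treated with the outer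
  factor fixed, and then the whole expression as a function of all factors. The right action on
  \<open>X\<close> is a derived operation whose value is a sum of elements of \<open>X\<close>. Its
  coaction is therefore not given by an axiom: \<open>rho\<close> has to be moved through that sum
  (\<open>frag_extend_additive\<close>) before coassociativity can be applied.\<close>

definition is_subgroup :: "'g::ab_group_add set \<Rightarrow> bool"
  where "is_subgroup N \<longleftrightarrow> 0 \<in> N \<and> (\<forall>a\<in>N. \<forall>b\<in>N. a - b \<in> N)"

lemma is_subgroup_group_closure [simp]: "is_subgroup (group_closure S)"
  by (simp add: is_subgroup_def group_closure.diff)

lemma is_subgroup_tens2 [simp]: "is_subgroup (tens2 rA lB)"
  by (simp add: tens2_def)

lemma is_subgroup_tens3 [simp]: "is_subgroup (tens3 rA lB rB lC)"
  by (simp add: tens3_def)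

lemma is_subgroup_cyc_rel [simp]: "is_subgroup (cyc_rel phi lX rX n)"
  by (simp add: cyc_rel_def)

lemma subgroup_zero: "is_subgroup N \<Longrightarrow> 0 \<in> N"
  by (simp add: is_subgroup_def)

lemma subgroup_diff: "is_subgroup N \<Longrightarrow> a \<in> N \<Longrightarrow> b \<in> N \<Longrightarrow> a - b \<in> N"
  by (simp add: is_subgroup_def)

lemma subgroup_uminus: "is_subgroup N \<Longrightarrow> a \<in> N \<Longrightarrow> - a \<in> N"
  using subgroup_diff [of N 0 a] by (simp add: subgroup_zero)

lemma subgroup_add: "is_subgroup N \<Longrightarrow> a \<in> N \<Longrightarrow> b \<in> N \<Longrightarrow> a + b \<in> N"
  using subgroup_diff [of N a "- b"] by (simp add: subgroup_uminus)

lemma coset_eq_iff: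
  assumes "is_subgroup N"
  shows "p +o N = q +o N \<longleftrightarrow> p - q \<in> N"
proof
  assume "p +o N = q +o N"
  moreover have "p \<in> p +o N"
    using subgroup_zero [OF assms] by (metis add.right_neutral set_plus_intro2)
  ultimately show "p - q \<in> N"
    by (simp add: set_minus_plus)
next
  assume pq: "p - q \<in> N"
  have *: "x - q \<in> N \<longleftrightarrow> x - p \<in> N" for x
  proof
    assume "x - q \<in> N"
    then have "(x - q) - (p - q) \<in> N" using pq assms by (blast intro: subgroup_diff)
    then show "x - p \<in> N" by simp
  next
    assume "x - p \<in> N"
    then have "(x - p) + (p - q) \<in> N" using pq assms by (blast intro: subgroup_add)
    then show "x - q \<in> N" by simp
  qed
  show "p +o N = q +o N"
    by (auto simp: set_minus_plus [symmetric] *)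
qed

lemma coset_add:
  assumes "is_subgroup N"
  shows "(p +o N) + (q +o N) = (p + q) +o N"
proof -
  have "N + N = N"
    using assms by (auto simp: set_plus_def subgroup_add intro: subgroup_zero)
      (metis add.right_neutral subgroup_zero)
  then show ?thesis by (simp add: set_plus_rearrange)
qed

lemma frag_extend_frag_extend:
  "frag_extend f (frag_extend g p) = frag_extend (\<lambda>a. frag_extend f (g a)) p"
  by (rule frag_induction [of p UNIV]) (auto simp: frag_extend_diff)

lemma frag_extend_add_fun:
  "frag_extend (\<lambda>a. f a + g a) p = frag_extend f p + frag_extend g p"
  by (rule frag_induction [of p UNIV]) (auto simp: frag_extend_diff)

text \<open>The difference of the two sums is the extension of \<open>f - g\<close>, a combination
  of elements of \<open>N\<close>. Restricting the premise to generators of \<open>p\<close> later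
  allows side conditions such as a fixed list length.\<close>

lemma frag_extend_coset_cong:
  assumes "is_subgroup N" and "\<And>a. a \<in> Poly_Mapping.keys p \<Longrightarrow> f a +o N = g a +o N"
  shows "frag_extend f p +o N = frag_extend g p +o N"
proof -
  have "frag_extend (\<lambda>a. f a - g a) p \<in> N \<and>
      frag_extend (\<lambda>a. f a - g a) p = frag_extend f p - frag_extend g p"
    using subset_refl [of "Poly_Mapping.keys p"]
  proof (induction rule: frag_induction)
    case (one x)
    then show ?case using assms by (simp add: coset_eq_iff)
  qed (use assms in \<open>auto simp: subgroup_zero frag_extend_diff intro: subgroup_diff\<close>)
  then show ?thesis by (elim conjE) (simp add: coset_eq_iff [OF assms(1)])
qed

text \<open>This is the condition under which the additive extension of \<open>f\<close> maps each
  coset of \<open>M\<close> into a single coset of \<open>N\<close>.\<close>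

definition descends :: "('a \<Rightarrow>\<^sub>0 int) set \<Rightarrow> ('b \<Rightarrow>\<^sub>0 int) set \<Rightarrow> ('a \<Rightarrow> 'b \<Rightarrow>\<^sub>0 int) \<Rightarrow> bool"
  where "descends M N f \<longleftrightarrow> (\<forall>m\<in>M. frag_extend f m \<in> N)"

lemma descends_group_closure:
  assumes "is_subgroup N" and "\<And>m. m \<in> S \<Longrightarrow> frag_extend f m \<in> N"
  shows "descends (group_closure S) N f"
proof -
  have "frag_extend f m \<in> N" if "m \<in> group_closure S" for m
    using that
    by induction (use assms in \<open>auto simp: frag_extend_diff subgroup_zero intro: subgroup_diff\<close>)
  then show ?thesis by (simp add: descends_def)
qed

lemma descends_coset:
  assumes "descends M N f" "is_subgroup M" "is_subgroup N" "p +o M = q +o M"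
  shows "frag_extend f p +o N = frag_extend f q +o N"
  using assms by (simp add: coset_eq_iff descends_def flip: frag_extend_diff)

text \<open>The union in \<open>induced\<close> runs over two choices: a representative
  \<open>q\<close> of the coset and an element \<open>h a\<close> of each coset \<open>f a\<close>.
  Changing \<open>h\<close> alters the result by an element of \<open>N\<close>, and so does
  changing \<open>q\<close>, because \<open>g\<close> descends. Hence all members of the union
  coincide, and \<open>p\<close> and \<open>g\<close> compute it.\<close>

lemma induced_coset:
  assumes "descends M N g" "is_subgroup M" "is_subgroup N" and f: "\<And>a. f a = g a +o N"
  shows "induced N f (p +o M) = frag_extend g p +o N"
proof -
  have *: "frag_extend h q +o N = frag_extend g p +o N"
    if "q \<in> p +o M" and "\<forall>a\<in>Poly_Mapping.keys q. h a \<in> f a" for q h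
  proof -
    have "frag_extend h q +o N = frag_extend g q +o N"
      using that(2) assms(3) f
      by (intro frag_extend_coset_cong) (auto simp: coset_eq_iff set_minus_plus)
    also have "\<dots> = frag_extend g p +o N"
      using that(1) assms by (intro descends_coset [OF assms(1)]) (auto simp: coset_eq_iff set_minus_plus)
    finally show ?thesis .
  qed
  have "p \<in> p +o M"
    using assms(2) by (simp add: set_minus_plus [symmetric] subgroup_zero)
  moreover have "\<forall>a\<in>Poly_Mapping.keys p. g a \<in> f a"
    using assms(3) f by (simp add: set_minus_plus [symmetric] subgroup_zero)
  ultimately show ?thesis
    unfolding induced_def using * by fast
qed

lemma induced_pure:
  "\<lbrakk>descends M N g; is_subgroup M; is_subgroup N; \<And>a. f a = g a +o N\<rbrakk> \<Longrightarrow>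
    induced N f (pure M a) = g a +o N"
  unfolding pure_def by (subst induced_coset) auto

lemma quot_cosetE:
  assumes "c \<in> quot A N"
  obtains p where "c = p +o N" "Poly_Mapping.keys p \<subseteq> A"
  using assms by (auto simp: quot_def)

text \<open>Universal property of the tensor product; biadditivity and balancedness may hold merely
  modulo \<open>N\<close>.\<close>

lemma descends_tens2:
  assumes "is_subgroup N"
    and "\<And>a a' b. f (a + a', b) +o N = (f (a, b) + f (a', b)) +o N"
    and "\<And>a b b'. f (a, b + b') +o N = (f (a, b) + f (a, b')) +o N"
    and "\<And>r a b. f (rA r a, b) +o N = f (a, lB r b) +o N"
  shows "descends (tens2 rA lB) N f"
  unfolding tens2_def using assms
  by (intro descends_group_closure) (auto simp: frag_extend_diff frag_extend_add coset_eq_iff diff_diff_eq)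

lemma descends_tens3:
  assumes "is_subgroup N"
    and "\<And>a a' b c. f (a + a', b, c) +o N = (f (a, b, c) + f (a', b, c)) +o N"
    and "\<And>a b b' c. f (a, b + b', c) +o N = (f (a, b, c) + f (a, b', c)) +o N"
    and "\<And>a b c c'. f (a, b, c + c') +o N = (f (a, b, c) + f (a, b, c')) +o N"
    and "\<And>r a b c. f (rA r a, b, c) +o N = f (a, lB r b, c) +o N"
    and "\<And>r a b c. f (a, rB r b, c) +o N = f (a, b, lC r c) +o N"
  shows "descends (tens3 rA lB rB lC) N f"
  unfolding tens3_def using assms
  by (intro descends_group_closure) (auto simp: frag_extend_diff frag_extend_add coset_eq_iff diff_diff_eq)

lemma tens2_add_left: "frag_of (a + a', b) +o tens2 rA lB = (frag_of (a, b) + frag_of (a', b)) +o tens2 rA lB"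
  by (simp add: coset_eq_iff, unfold tens2_def, rule group_closure.base) (force simp: diff_diff_eq [symmetric])

lemma tens2_add_right: "frag_of (a, b + b') +o tens2 rA lB = (frag_of (a, b) + frag_of (a, b')) +o tens2 rA lB"
  by (simp add: coset_eq_iff, unfold tens2_def, rule group_closure.base) (force simp: diff_diff_eq [symmetric])

lemma tens2_balanced: "frag_of (rA r a, b) +o tens2 rA lB = frag_of (a, lB r b) +o tens2 rA lB"
  by (simp add: coset_eq_iff, unfold tens2_def, rule group_closure.base) force

lemma tens3_add_left:
  "frag_of (a + a', b, c) +o tens3 rA lB rB lC = (frag_of (a, b, c) + frag_of (a', b, c)) +o tens3 rA lB rB lC"
  by (simp add: coset_eq_iff, unfold tens3_def, rule group_closure.base) (force simp: diff_diff_eq [symmetric])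

lemma tens3_add_middle:
  "frag_of (a, b + b', c) +o tens3 rA lB rB lC = (frag_of (a, b, c) + frag_of (a, b', c)) +o tens3 rA lB rB lC"
  by (simp add: coset_eq_iff, unfold tens3_def, rule group_closure.base) (force simp: diff_diff_eq [symmetric])

lemma tens3_add_right:
  "frag_of (a, b, c + c') +o tens3 rA lB rB lC = (frag_of (a, b, c) + frag_of (a, b, c')) +o tens3 rA lB rB lC"
  by (simp add: coset_eq_iff, unfold tens3_def, rule group_closure.base) (force simp: diff_diff_eq [symmetric])

lemma tens3_balanced_left: "frag_of (rA r a, b, c) +o tens3 rA lB rB lC = frag_of (a, lB r b, c) +o tens3 rA lB rB lC"
  by (simp add: coset_eq_iff, unfold tens3_def, rule group_closure.base) blast

lemma tens3_balanced_right: "frag_of (a, rB r b, c) +o tens3 rA lB rB lC = frag_of (a, b, lC r c) +o tens3 rA lB rB lC"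
  by (simp add: coset_eq_iff, unfold tens3_def, rule group_closure.base) blast

section \<open>Additive maps into abelian groups\<close>

text \<open>The sum evaluated by \<open>induced_val\<close>. It is the analogue of
  \<open>frag_extend\<close> for values in an abelian group, such as those in the counit axioms and
  in the product rule for the action on \<open>T\<close>.\<close>

definition frag_val :: "('a \<Rightarrow> 'm::ab_group_add) \<Rightarrow> ('a \<Rightarrow>\<^sub>0 int) \<Rightarrow> 'm"
  where "frag_val f p = (\<Sum>a\<in>Poly_Mapping.keys p. int_mult (Poly_Mapping.lookup p a) (f a))"

lemma int_mult_0 [simp]: "int_mult 0 x = 0"
  by (simp add: int_mult_def)

text \<open>At every integer at least one of the two sums in \<open>int_mult\<close> is empty, so
  adding 1 either lengthens the first sum or shortens the second.\<close>

lemma int_mult_succ: "int_mult (z + 1) x = int_mult z x + x"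
proof (cases "z \<ge> 0")
  case True
  then have "nat (z + 1) = Suc (nat z)" "nat (- (z + 1)) = 0" "nat (- z) = 0" by auto
  then show ?thesis by (simp add: int_mult_def)
next
  case False
  then have "nat (z + 1) = 0" "nat (- z) = Suc (nat (- (z + 1)))" "nat z = 0" by auto
  then show ?thesis by (simp add: int_mult_def)
qed

lemma int_mult_add: "int_mult (z + w) x = int_mult z x + int_mult w x"
proof (induction w rule: int_induct [where k = 0])
  case (step1 i)
  then show ?case by (simp add: int_mult_succ add.assoc [symmetric])
next
  case (step2 i)
  have "int_mult (z + i) x = int_mult (z + (i - 1)) x + x"
    using int_mult_succ [of "z + (i - 1)" x] by (simp add: algebra_simps)
  moreover have "int_mult i x = int_mult (i - 1) x + x"
    using int_mult_succ [of "i - 1" x] by simp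
  ultimately show ?case using step2 by (simp add: algebra_simps)
qed simp

lemma int_mult_1 [simp]: "int_mult 1 x = x"
  using int_mult_succ [of 0 x] by simp

lemma frag_val_of [simp]: "frag_val f (frag_of a) = f a"
  by (simp add: frag_val_def)

lemma frag_val_0 [simp]: "frag_val f 0 = 0"
  by (simp add: frag_val_def)

text \<open>Cancellation can remove keys from \<open>p + q\<close>, so additivity compares sums over
  a common finite set; the additional terms are zero multiples.\<close>

lemma frag_val_superset:
  assumes "finite S" "Poly_Mapping.keys p \<subseteq> S"
  shows "frag_val f p = (\<Sum>a\<in>S. int_mult (Poly_Mapping.lookup p a) (f a))"
  unfolding frag_val_def using assms
  by (intro sum.mono_neutral_left) (auto simp: in_keys_iff)

lemma frag_val_add: "frag_val f (p + q) = frag_val f p + frag_val f q"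
proof -
  let ?S = "Poly_Mapping.keys p \<union> Poly_Mapping.keys q"
  have "Poly_Mapping.keys (p + q) \<subseteq> ?S" by (rule Poly_Mapping.keys_add)
  then show ?thesis
    by (simp add: frag_val_superset [of ?S] lookup_add int_mult_add sum.distrib)
qed

lemma frag_val_diff: "frag_val f (p - q) = frag_val f p - frag_val f q"
  using frag_val_add [of f "p - q" q] by (simp add: algebra_simps)

lemma frag_val_cong: "(\<And>a. a \<in> Poly_Mapping.keys p \<Longrightarrow> f a = g a) \<Longrightarrow> frag_val f p = frag_val g p"
  by (simp add: frag_val_def)

lemma frag_val_frag_extend: "frag_val f (frag_extend g p) = frag_val (\<lambda>a. frag_val f (g a)) p"
  by (rule frag_induction [of p UNIV]) (auto simp: frag_extend_diff frag_val_diff)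

lemma additive_diff:
  fixes h :: "'n::ab_group_add \<Rightarrow> 'm::ab_group_add"
  assumes "\<And>x y. h (x + y) = h x + h y"
  shows "h (x - y) = h x - h y"
  using assms [of "x - y" y] by (simp add: algebra_simps)

lemma additive_frag_val:
  fixes h :: "'n::ab_group_add \<Rightarrow> 'm::ab_group_add"
  assumes h: "\<And>x y. h (x + y) = h x + h y"
  shows "h (frag_val f p) = frag_val (\<lambda>a. h (f a)) p"
proof (rule frag_induction [of p UNIV])
  show "h (frag_val f 0) = frag_val (\<lambda>a. h (f a)) 0" using h [of 0 0] by simp
qed (auto simp: frag_val_diff additive_diff [of h, OF h])

text \<open>Collects a sum inside one tensor factor, such as a counit expression, into a single
  element. Typical choices of \<open>F\<close> are the representative \<open>P\<close>, which is
  additive only modulo relations, and the insertion \<open>\<lambda>c. frag_of (c, y)\<close> into a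
  tensor product.\<close>

lemma frag_extend_additive:
  assumes N: "is_subgroup N" and F: "\<And>x y. F (x + y) +o N = (F x + F y) +o N"
  shows "frag_extend (\<lambda>a. F (f a)) p +o N = F (frag_val f p) +o N"
proof (rule frag_induction [of p UNIV])
  have 0: "F 0 \<in> N"
    using F [of 0 0] N by (simp add: coset_eq_iff) (metis minus_minus subgroup_uminus)
  then show "frag_extend (\<lambda>a. F (f a)) 0 +o N = F (frag_val f 0) +o N"
    using N coset_eq_iff [OF N, of 0 "F 0"] by (simp add: subgroup_uminus)
next
  fix p q
  assume "frag_extend (\<lambda>a. F (f a)) p +o N = F (frag_val f p) +o N"
    and "frag_extend (\<lambda>a. F (f a)) q +o N = F (frag_val f q) +o N"
  then have "(frag_extend (\<lambda>a. F (f a)) p - F (frag_val f p))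
      - (frag_extend (\<lambda>a. F (f a)) q - F (frag_val f q)) \<in> N"
    using N by (auto simp: coset_eq_iff intro: subgroup_diff)
  \<comment> \<open>Additivity of \<open>F\<close> is given for sums, so the difference
    \<open>u - v\<close> is treated through \<open>u = (u - v) + v\<close>.\<close>
  moreover have "F (frag_val f p) - (F (frag_val f p - frag_val f q) + F (frag_val f q)) \<in> N"
    using F [of "frag_val f p - frag_val f q" "frag_val f q"] N by (simp add: coset_eq_iff)
  ultimately have "(frag_extend (\<lambda>a. F (f a)) p - F (frag_val f p))
      - (frag_extend (\<lambda>a. F (f a)) q - F (frag_val f q))
      + (F (frag_val f p) - (F (frag_val f p - frag_val f q) + F (frag_val f q))) \<in> N"
    using N by (rule_tac subgroup_add)
  then show "frag_extend (\<lambda>a. F (f a)) (p - q) +o N = F (frag_val f (p - q)) +o N"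
    using N by (simp add: coset_eq_iff frag_extend_diff frag_val_diff algebra_simps)
qed auto

definition descends_val :: "('a \<Rightarrow>\<^sub>0 int) set \<Rightarrow> ('a \<Rightarrow> 'm::ab_group_add) \<Rightarrow> bool"
  where "descends_val M f \<longleftrightarrow> (\<forall>m\<in>M. frag_val f m = 0)"

lemma descends_val_coset:
  "\<lbrakk>descends_val M f; is_subgroup M; p +o M = q +o M\<rbrakk> \<Longrightarrow> frag_val f p = frag_val f q"
  by (metis coset_eq_iff descends_val_def frag_val_diff eq_iff_diff_eq_0)

text \<open>All representatives of the coset have the same value, so \<open>the_elem\<close> is
  applied to a singleton.\<close>

lemma induced_val_coset:
  assumes "descends_val M f" "is_subgroup M"
  shows "induced_val f (p +o M) = frag_val f p"
proof -
  have "frag_val f q = frag_val f p" if "q \<in> p +o M" for q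
    using that assms by (intro descends_val_coset [of M]) (simp_all add: coset_eq_iff set_minus_plus)
  moreover have "p \<in> p +o M"
    using assms(2) by (simp add: set_minus_plus [symmetric] subgroup_zero)
  ultimately have "frag_val f ` (p +o M) = {frag_val f p}" by blast
  then show ?thesis by (simp add: induced_val_def frag_val_def [abs_def])
qed

lemma descends_val_tens2:
  assumes "\<And>a a' b. f (a + a', b) = f (a, b) + f (a', b)"
    and "\<And>a b b'. f (a, b + b') = f (a, b) + f (a, b')"
    and "\<And>r a b. f (rA r a, b) = f (a, lB r b)"
  shows "descends_val (tens2 rA lB) f"
proof -
  have "frag_val f m = 0" if "m \<in> tens2 rA lB" for m
    using that unfolding tens2_def
    by induction (auto simp: frag_val_diff assms)
  then show ?thesis by (simp add: descends_val_def)
qed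

section \<open>Cyclic tensor powers\<close>

lemma cyc_relI:
  "m \<in> tens_pow_rel phi lX n \<Longrightarrow> m \<in> cyc_rel phi lX rX n"
  unfolding cyc_rel_def by (rule group_closure.base) simp

text \<open>This and the following rules locate a slot by splitting the list, where
  \<open>tens_pow_rel\<close> updates an index. The position is then the length of
  \<open>us\<close>, and insertion, multiplication and rotation can be computed on the two
  pieces.\<close>

lemma cyc_add:
  assumes "length us + length vs = n"
  shows "frag_of (us @ (a + b) # vs, x) +o cyc_rel phi lX rX n =
    (frag_of (us @ a # vs, x) + frag_of (us @ b # vs, x)) +o cyc_rel phi lX rX n"
proof -
  have "frag_of (us @ (a + b) # vs, x) - frag_of (us @ a # vs, x) - frag_of (us @ b # vs, x)
      \<in> tens_pow_rel phi lX n"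
    unfolding tens_pow_rel_def using assms
    by (intro group_closure.base insertI2 UnI1 CollectI exI [of _ "us @ a # vs"] exI [of _ "length us"]
        exI [of _ a] exI [of _ b] exI [of _ x]) simp
  then show ?thesis
    by (simp add: coset_eq_iff diff_diff_eq cyc_relI)
qed

lemma cyc_add_right:
  assumes "length ts = Suc n"
  shows "frag_of (ts, x + y) +o cyc_rel phi lX rX n =
    (frag_of (ts, x) + frag_of (ts, y)) +o cyc_rel phi lX rX n"
proof -
  have "frag_of (ts, x + y) - frag_of (ts, x) - frag_of (ts, y) \<in> tens_pow_rel phi lX n"
    unfolding tens_pow_rel_def using assms by (intro group_closure.base) blast
  then show ?thesis
    by (simp add: coset_eq_iff diff_diff_eq cyc_relI)
qed

lemma cyc_balanced:
  assumes "length us + length vs + 1 = n"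
  shows "frag_of (us @ (a * phi r) # b # vs, x) +o cyc_rel phi lX rX n =
    frag_of (us @ a # (phi r * b) # vs, x) +o cyc_rel phi lX rX n"
proof -
  have "frag_of (us @ (a * phi r) # b # vs, x) - frag_of (us @ a # (phi r * b) # vs, x)
      \<in> tens_pow_rel phi lX n"
    unfolding tens_pow_rel_def using assms
    by (intro group_closure.base insertI2 UnI1 [OF UnI2] CollectI exI [of _ "us @ a # b # vs"]
        exI [of _ "length us"] exI [of _ r] exI [of _ x]) (simp add: nth_append list_update_append)
  then show ?thesis
    by (simp add: coset_eq_iff cyc_relI)
qed

lemma cyc_balanced_end:
  assumes "length us = n"
  shows "frag_of (us @ [a * phi r], x) +o cyc_rel phi lX rX n =
    frag_of (us @ [a], lX r x) +o cyc_rel phi lX rX n"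
proof -
  have "frag_of (us @ [a * phi r], x) - frag_of (us @ [a], lX r x) \<in> tens_pow_rel phi lX n"
    unfolding tens_pow_rel_def using assms
    by (intro group_closure.base insertI2 UnI2 CollectI exI [of _ "us @ [a]"]
        exI [of _ r] exI [of _ x]) (simp add: nth_append list_update_append)
  then show ?thesis
    by (simp add: coset_eq_iff cyc_relI)
qed

lemma cyc_cyclic:
  assumes "length ts = n"
  shows "frag_of (phi r * a # ts, x) +o cyc_rel phi lX rX n =
    frag_of (a # ts, rX r x) +o cyc_rel phi lX rX n"
proof -
  have "frag_of (phi r * a # ts, x) - frag_of (a # ts, rX r x) \<in> cyc_rel phi lX rX n"
    unfolding cyc_rel_def using assms
    by (intro group_closure.base insertI2 UnI2 CollectI exI [of _ r] exI [of _ "frag_of (a # ts, x)"])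
      (simp add: tuples_def)
  then show ?thesis
    by (simp add: coset_eq_iff)
qed

text \<open>Universal property of the cyclic tensor product. \<open>balanced\<close> concerns two
  neighbours in \<open>T\<close>, \<open>balanced_end\<close> the last factor in \<open>T\<close>
  and the factor in \<open>X\<close>, and \<open>cyclic\<close> closes the circle from
  \<open>X\<close> to the first factor.\<close>

lemma descends_cyc_rel:
  fixes f :: "'t::{ring,monoid_mult} list \<times> 'x::ab_group_add \<Rightarrow> 'c \<Rightarrow>\<^sub>0 int"
  assumes M: "is_subgroup M"
    and add: "\<And>us a b vs x. length us + length vs = n \<Longrightarrow>
      f (us @ (a + b) # vs, x) +o M = (f (us @ a # vs, x) + f (us @ b # vs, x)) +o M"
    and add_right: "\<And>ts x y. length ts = Suc n \<Longrightarrow> f (ts, x + y) +o M = (f (ts, x) + f (ts, y)) +o M"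
    and balanced: "\<And>us a b vs r x. length us + length vs + 1 = n \<Longrightarrow>
      f (us @ (a * phi r) # b # vs, x) +o M = f (us @ a # (phi r * b) # vs, x) +o M"
    and balanced_end: "\<And>us a r x. length us = n \<Longrightarrow>
      f (us @ [a * phi r], x) +o M = f (us @ [a], lX r x) +o M"
    and cyclic: "\<And>ts a r x. length ts = n \<Longrightarrow>
      f (phi r * a # ts, x) +o M = f (a # ts, rX r x) +o M"
  shows "descends (cyc_rel phi lX rX n) M f"
proof -
  have 1: "descends (tens_pow_rel phi lX n) M f"
    unfolding tens_pow_rel_def
  proof (rule descends_group_closure [OF M], elim UnE CollectE exE conjE)
    fix m i a b and ts :: "'t list" and x :: 'x
    assume m: "m = frag_of (ts[i := a + b], x) - frag_of (ts[i := a], x) - frag_of (ts[i := b], x)"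
      and "length ts = Suc n" "i \<le> n"
    then have "f (ts[i := a + b], x) +o M = (f (ts[i := a], x) + f (ts[i := b], x)) +o M"
      using add [of "take i ts" "drop (Suc i) ts"] by (simp add: upd_conv_take_nth_drop min_def)
    then show "frag_extend f m \<in> M"
      using M by (simp add: m frag_extend_diff frag_extend_add coset_eq_iff diff_diff_eq)
  next
    fix m and ts :: "'t list" and x y :: 'x
    assume m: "m = frag_of (ts, x + y) - frag_of (ts, x) - frag_of (ts, y)" and "length ts = Suc n"
    then show "frag_extend f m \<in> M"
      using M add_right [of ts x y] by (simp add: frag_extend_diff frag_extend_add coset_eq_iff diff_diff_eq)
  next
    fix m i r and ts :: "'t list" and x :: 'x
    assume m: "m = frag_of (ts[i := ts ! i * phi r], x) - frag_of (ts[Suc i := phi r * ts ! Suc i], x)"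
      and len: "length ts = Suc n" and i: "i < n"
    obtain us a b vs where ts: "ts = us @ a # b # vs" and us: "length us = i"
    proof
      show "ts = take i ts @ ts ! i # ts ! Suc i # drop (Suc (Suc i)) ts"
        using len i by (simp add: Cons_nth_drop_Suc)
      show "length (take i ts) = i" using len i by simp
    qed
    have "f (ts[i := ts ! i * phi r], x) +o M = f (ts[Suc i := phi r * ts ! Suc i], x) +o M"
      using balanced [of us vs a r b x] len i by (simp add: ts us nth_append list_update_append)
    then show "frag_extend f m \<in> M"
      using M by (simp add: m frag_extend_diff coset_eq_iff)
  next
    fix m r and ts :: "'t list" and x :: 'x
    assume m: "m = frag_of (ts[n := ts ! n * phi r], x) - frag_of (ts, lX r x)"
      and len: "length ts = Suc n"
    obtain us a where ts: "ts = us @ [a]" and us: "length us = n"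
      using len by (metis length_append_singleton nat.inject length_Suc_conv_rev)
    show "frag_extend f m \<in> M"
      using M balanced_end [of us a r x]
      by (simp add: m ts us frag_extend_diff coset_eq_iff nth_append list_update_append)
  qed
  show ?thesis
    unfolding cyc_rel_def
  proof (rule descends_group_closure [OF M], elim UnE CollectE exE conjE)
    fix m assume "m \<in> tens_pow_rel phi lX n"
    then show "frag_extend f m \<in> M" using 1 by (simp add: descends_def)
  next
    fix m r and y :: "'t list \<times> 'x \<Rightarrow>\<^sub>0 int"
    assume m: "m = frag_extend (\<lambda>(ts, x). frag_of (ts[0 := phi r * ts ! 0], x)) y
        - frag_extend (\<lambda>(ts, x). frag_of (ts, rX r x)) y"
      and y: "Poly_Mapping.keys y \<subseteq> tuples n"
    \<comment> \<open>Both actions on \<open>y\<close> are extended additively from generators, and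
      every generator in \<open>y\<close> has a list of length \<open>Suc n\<close>; so
      \<open>cyclic\<close> applies to each summand.\<close>
    have "f (ts[0 := phi r * ts ! 0], x) +o M = f (ts, rX r x) +o M" if "length ts = Suc n" for ts :: "'t list" and x :: 'x
      using cyclic [of "tl ts" r "hd ts" x] that by (cases ts) auto
    then have "frag_extend (\<lambda>(ts, x). f (ts[0 := phi r * ts ! 0], x)) y +o M =
        frag_extend (\<lambda>(ts, x). f (ts, rX r x)) y +o M"
      using y by (intro frag_extend_coset_cong [OF M]) (auto simp: tuples_def)
    then show "frag_extend f m \<in> M"
      using M by (simp add: m frag_extend_diff frag_extend_frag_extend coset_eq_iff split_def)
  qed
qed

section \<open>List forms of the cofaces and codegeneracies\<close>

definition insert_one :: "nat \<Rightarrow> 't::one list \<Rightarrow> 't list"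
  where "insert_one k ts = take k ts @ 1 # drop k ts"

definition mult_at :: "nat \<Rightarrow> 't::times list \<Rightarrow> 't list"
  where "mult_at k ts = take k ts @ (ts ! k * ts ! Suc k) # drop (Suc (Suc k)) ts"

text \<open>The rules at \<open>0\<close> and \<open>Suc\<close> turn both operations into recursive
  ones, so that the cosimplicial identities can be proved by induction on the position.\<close>

lemma insert_one_0 [simp]: "insert_one 0 ts = 1 # ts"
  by (simp add: insert_one_def)

lemma insert_one_Suc [simp]: "insert_one (Suc k) (t # ts) = t # insert_one k ts"
  by (simp add: insert_one_def)

lemma mult_at_0 [simp]: "mult_at 0 (a # b # ts) = a * b # ts"
  by (simp add: mult_at_def)

lemma mult_at_Suc [simp]: "mult_at (Suc k) (t # ts) = t # mult_at k ts"
  by (simp add: mult_at_def)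

lemma length_insert_one [simp]: "length (insert_one k ts) = Suc (length ts)"
  by (simp add: insert_one_def)

lemma length_mult_at [simp]: "Suc k < length ts \<Longrightarrow> length (mult_at k ts) = length ts - 1"
  by (simp add: mult_at_def)

text \<open>The boundary case \<open>k = length us\<close> is assigned to \<open>us\<close>; in the
  other branch the unit therefore goes strictly behind the head of \<open>vs\<close>.\<close>

lemma insert_one_append:
  "insert_one k (us @ vs) = (if k \<le> length us then insert_one k us @ vs else us @ insert_one (k - length us) vs)"
  by (simp add: insert_one_def)

lemma mult_at_append_left: "Suc k < length us \<Longrightarrow> mult_at k (us @ vs) = mult_at k us @ vs"
  by (simp add: mult_at_def nth_append)

lemma mult_at_append_right: "mult_at (length us + k) (us @ vs) = us @ mult_at k vs"
  by (simp add: mult_at_def nth_append)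

lemma insert_one_insert_one:
  "i < j \<Longrightarrow> j \<le> Suc (length ts) \<Longrightarrow>
    insert_one j (insert_one i ts) = insert_one i (insert_one (j - 1) ts)"
proof (induction i arbitrary: j ts)
  case 0
  then show ?case by (cases j) auto
next
  case (Suc i)
  then obtain j' where j: "j = Suc j'" by (cases j) auto
  with Suc.prems obtain j'' where j': "j' = Suc j''" by (cases j') auto
  with Suc j show ?case by (cases ts) auto
qed

text \<open>The case \<open>i = j = 0\<close> is associativity. In all other cases the induction
  strips equal heads or the two products involve separate entries.\<close>

lemma mult_at_mult_at:
  fixes ts :: "'t::semigroup_mult list"
  shows "i \<le> j \<Longrightarrow> Suc (Suc j) < length ts \<Longrightarrow> mult_at j (mult_at i ts) = mult_at i (mult_at (Suc j) ts)"
proof (induction i arbitrary: j ts)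
  case 0
  then obtain a b c us where "ts = a # b # c # us"
    by (auto simp: Suc_le_eq [symmetric] Suc_le_length_iff)
  then show ?case by (cases j) (auto simp: mult.assoc)
next
  case (Suc i)
  then obtain j' where "j = Suc j'" by (cases j) auto
  with Suc show ?case by (cases ts) auto
qed

lemma mult_at_insert_one_less:
  "i < j \<Longrightarrow> j < length ts  \<Longrightarrow>
    mult_at j (insert_one i ts) = insert_one i (mult_at (j - 1) ts)"
proof (induction i arbitrary: j ts)
  case 0
  then obtain j' where "j = Suc j'" by (cases j) auto
  then show ?case by simp
next
  case (Suc i)
  then obtain j' where j: "j = Suc j'" by (cases j) auto
  with Suc.prems obtain j'' where j': "j' = Suc j''" by (cases j') auto
  with Suc j show ?case by (cases ts) auto
qed

lemma mult_at_insert_one_eq: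
  fixes ts :: "'t::monoid_mult list"
  shows "j < length ts \<Longrightarrow> i = j \<or> i = Suc j \<Longrightarrow> mult_at j (insert_one i ts) = ts"
proof (induction j arbitrary: i ts)
  case 0
  then show ?case by (cases ts) auto
next
  case (Suc j)
  then show ?case by (cases ts; cases i) auto
qed

lemma mult_at_insert_one_greater:
  "Suc j < i \<Longrightarrow> i \<le> length ts \<Longrightarrow> mult_at j (insert_one i ts) = insert_one (i - 1) (mult_at j ts)"
proof (induction j arbitrary: i ts)
  case 0
  then obtain i' where "i = Suc (Suc i')" by (cases i; cases "i - 1") auto
  moreover from 0 obtain a b us where "ts = a # b # us"
    by (cases ts; cases "tl ts") auto
  ultimately show ?case by simp
next
  case (Suc j)
  then obtain i' where i: "i = Suc i'" by (cases i) auto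
  with Suc.prems obtain i'' where "i' = Suc i''" by (cases i') auto
  with Suc i show ?case by (cases ts) auto
qed

section \<open>Commuting squares, linear maps and modules on quotients\<close>

lemma frag_extend_comp_coset_cong:
  assumes "is_subgroup N" "Poly_Mapping.keys p \<subseteq> A"
    and "\<And>a. a \<in> A \<Longrightarrow> frag_extend f (g a) +o N = frag_extend f' (g' a) +o N"
  shows "frag_extend f (frag_extend g p) +o N = frag_extend f' (frag_extend g' p) +o N"
  unfolding frag_extend_frag_extend using assms by (intro frag_extend_coset_cong) auto

lemma keys_frag_extend_subset:
  "Poly_Mapping.keys p \<subseteq> A \<Longrightarrow> (\<And>a. a \<in> A \<Longrightarrow> Poly_Mapping.keys (g a) \<subseteq> B) \<Longrightarrow>
    Poly_Mapping.keys (frag_extend g p) \<subseteq> B"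
  using keys_frag_extend [of g p] by fast

text \<open>Scalars also act through representatives, so compatibility with them is a commuting
  square that can be checked on the generators in \<open>A\<close>.\<close>

lemma linear_on_cosets:
  assumes M: "is_subgroup M" and N: "is_subgroup N"
    and f: "\<And>p. f (p +o M) = frag_extend g p +o N"
    and sc: "\<And>k p. sc k (p +o M) = frag_extend (h k) p +o M"
    and sc': "\<And>k p. sc' k (p +o N) = frag_extend (h' k) p +o N"
    and keys: "\<And>a. a \<in> A \<Longrightarrow> Poly_Mapping.keys (g a) \<subseteq> B"
    and commute: "\<And>k a. a \<in> A \<Longrightarrow> frag_extend g (h k a) +o N = frag_extend (h' k) (g a) +o N"
  shows "linear_on (quot A M) sc (quot B N) sc' f"
  unfolding linear_on_def
proof (intro conjI ballI allI)
  fix c assume "c \<in> quot A M"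
  then obtain p where c: "c = p +o M" "Poly_Mapping.keys p \<subseteq> A" by (rule quot_cosetE)
  then show "f c \<in> quot B N"
    using keys_frag_extend_subset [of p A g B] keys by (auto simp: f quot_def)
  show "f (sc k c) = sc' k (f c)" for k
    unfolding c(1) f sc sc' using commute
    by (rule frag_extend_comp_coset_cong [OF N c(2)])
  fix c' assume "c' \<in> quot A M"
  then obtain q where c': "c' = q +o M" by (rule quot_cosetE)
  show "f (c + c') = f c + f c'"
    by (simp add: c c' f coset_add M N frag_extend_add)
qed

lemma module_on_quot:
  assumes N: "is_subgroup N"
    and sc: "\<And>k p. sc k (p +o N) = frag_extend (h k) p +o N"
    and keys: "\<And>k a. a \<in> A \<Longrightarrow> Poly_Mapping.keys (h k a) \<subseteq> A"
    and add: "\<And>k l a. a \<in> A \<Longrightarrow> h (k + l) a +o N = (h k a + h l a) +o N"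
    and mult: "\<And>k l a. a \<in> A \<Longrightarrow> frag_extend (h k) (h l a) +o N = h (k * l) a +o N"
    and one: "\<And>a. a \<in> A \<Longrightarrow> h 1 a +o N = frag_of a +o N"
  shows "module_on (quot A N) sc"
proof
  fix c c' assume "c \<in> quot A N" "c' \<in> quot A N"
  then obtain p p' where c: "c = p +o N" "Poly_Mapping.keys p \<subseteq> A"
    and c': "c' = p' +o N" "Poly_Mapping.keys p' \<subseteq> A"
    by (meson quot_cosetE)
  show "c + c' \<in> quot A N"
    using c c' Poly_Mapping.keys_add [of p p'] by (auto simp: quot_def coset_add N)
  show "sc k (c + c') = sc k c + sc k c'" for k
    by (simp add: c c' sc coset_add N frag_extend_add)
next
  show "\<exists>z\<in>quot A N. \<forall>c\<in>quot A N. z + c = c \<and> (\<exists>c'\<in>quot A N. c + c' = z)"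
  \<comment> \<open>The neutral element is the coset \<open>N\<close> itself, written
    \<open>0 +o N\<close> to match \<open>coset_add\<close>; the zero \<open>{0}\<close> of the type
    of sets is not a coset unless \<open>N\<close> is trivial.\<close>
  proof (rule bexI [of _ "0 +o N"], intro ballI conjI)
    show "0 +o N \<in> quot A N" unfolding quot_def by (intro CollectI exI [of _ 0]) simp
    fix c assume "c \<in> quot A N"
    then obtain p where c: "c = p +o N" "Poly_Mapping.keys p \<subseteq> A" by (rule quot_cosetE)
    show "0 +o N + c = c" using coset_add [OF N, of 0 p] by (simp add: c)
    have "(- p) +o N \<in> quot A N" using c(2) unfolding quot_def
      by (intro CollectI exI [of _ "- p"]) simp
    moreover have "c + ((- p) +o N) = 0 +o N" by (simp add: c coset_add N del: set_zero_plus)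
    ultimately show "\<exists>c'\<in>quot A N. c + c' = 0 +o N" ..
  qed
next
  fix c k l assume "c \<in> quot A N"
  then obtain p where c: "c = p +o N" "Poly_Mapping.keys p \<subseteq> A" by (rule quot_cosetE)
  show "sc k c \<in> quot A N"
    using keys_frag_extend_subset [of p A "h k" A] keys c(2) by (auto simp: c sc quot_def)
  have "frag_extend (h (k + l)) p +o N = frag_extend (\<lambda>a. h k a + h l a) p +o N"
    using c(2) by (intro frag_extend_coset_cong N add) blast
  then show "sc (k + l) c = sc k c + sc l c"
    by (simp add: c(1) sc coset_add N frag_extend_add_fun)
  show "sc k (sc l c) = sc (k * l) c"
    unfolding c(1) sc frag_extend_frag_extend
    using c(2) by (intro frag_extend_coset_cong N mult) blast
  have "frag_extend (h 1) p +o N = frag_extend frag_of p +o N"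
    using c(2) by (intro frag_extend_coset_cong N one) blast
  then show "sc 1 c = c"
    by (simp add: c(1) sc flip: frag_expansion)
qed

section \<open>Transposition maps from representatives\<close>

text \<open>A transposition map given by representatives: \<open>W x t\<close> stands for the value
  at a pure tensor. \<open>W_balanced\<close> makes the map well defined, \<open>W_left\<close> and
  \<open>W_right\<close> are bimodule linearity, and \<open>W_one\<close> and \<open>W_mult\<close>
  express compatibility with unit and product of \<open>T\<close>. The construction of
  \<open>W\<close> is thereby separated from its consequences.\<close>

locale transposition_rep =
  k_algebra_map scale_R scale_T phi + X: bimodule scale_R lX rX
  for scale_R :: "'k::{comm_ring,comm_monoid_mult} \<Rightarrow> 'r::{ring,monoid_mult} \<Rightarrow> 'r"
    and scale_T :: "'k \<Rightarrow> 't::{ring,monoid_mult} \<Rightarrow> 't"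
    and phi :: "'r \<Rightarrow> 't"
    and lX :: "'r \<Rightarrow> 'x::ab_group_add \<Rightarrow> 'x"
    and rX :: "'r \<Rightarrow> 'x \<Rightarrow> 'x" +
  fixes W :: "'x \<Rightarrow> 't \<Rightarrow> ('t \<times> 'x \<Rightarrow>\<^sub>0 int)"
  fixes XT TX
  defines "XT \<equiv> tens2 rX (\<lambda>r t. phi r * t)"
    and "TX \<equiv> tens2 (\<lambda>r t. t * phi r) lX"
  assumes W_add_left: "W (x + y) t +o TX = (W x t + W y t) +o TX"
    and W_add_right: "W x (t + t') +o TX = (W x t + W x t') +o TX"
    and W_balanced: "W (rX r x) t +o TX = W x (phi r * t) +o TX"
    and W_left: "W (lX r x) t +o TX = frag_extend (\<lambda>(t', y). frag_of (phi r * t', y)) (W x t) +o TX"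
    and W_right: "W x (t * phi r) +o TX = frag_extend (\<lambda>(t', y). frag_of (t', rX r y)) (W x t) +o TX"
    and W_one: "W x 1 +o TX = frag_of (1, x) +o TX"
    and W_mult: "W x (t * t') +o TX =
      frag_extend (\<lambda>(s, y). frag_extend (\<lambda>(s', z). frag_of (s * s', z)) (W y t')) (W x t) +o TX"
begin

lemma subgroup_XT [simp]: "is_subgroup XT" and subgroup_TX [simp]: "is_subgroup TX"
  by (simp_all add: XT_def TX_def)

lemma TX_add_left: "frag_of (t + t', x) +o TX = (frag_of (t, x) + frag_of (t', x)) +o TX"
  and TX_add_right: "frag_of (t, x + y) +o TX = (frag_of (t, x) + frag_of (t, y)) +o TX"
  and TX_balanced: "frag_of (t * phi r, x) +o TX = frag_of (t, lX r x) +o TX"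
  unfolding TX_def by (rule tens2_add_left tens2_add_right tens2_balanced)+

lemma XT_add_left: "frag_of (x + y, t) +o XT = (frag_of (x, t) + frag_of (y, t)) +o XT"
  and XT_add_right: "frag_of (x, t + t') +o XT = (frag_of (x, t) + frag_of (x, t')) +o XT"
  and XT_balanced: "frag_of (rX r x, t) +o XT = frag_of (x, phi r * t) +o XT"
  unfolding XT_def
  by (rule tens2_add_left tens2_add_right tens2_balanced [where lB = "\<lambda>r t. phi r * t"])+

lemma W_descends: "descends XT TX (\<lambda>(x, t). W x t)"
  unfolding XT_def by (rule descends_tens2) (simp_all add: W_add_left W_add_right W_balanced)

lemma phi_mult_left_descends: "descends TX TX (\<lambda>(t, x). frag_of (phi r * t, x))"
  unfolding TX_def
  by (rule descends_tens2, fold TX_def)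
    (simp_all add: distrib_left TX_add_left TX_add_right TX_balanced flip: mult.assoc)

lemma right_act_descends: "descends TX TX (\<lambda>(t, x). frag_of (t, rX r x))"
  unfolding TX_def
  by (rule descends_tens2, fold TX_def)
    (simp_all add: X.right_add_right TX_add_left TX_add_right TX_balanced flip: X.left_right)

definition w_map :: "('x \<times> 't \<Rightarrow>\<^sub>0 int) set \<Rightarrow> ('t \<times> 'x \<Rightarrow>\<^sub>0 int) set"
  where "w_map = induced TX (\<lambda>(x, t). W x t +o TX)"

lemma w_map_coset: "w_map (p +o XT) = frag_extend (\<lambda>(x, t). W x t) p +o TX"
  unfolding w_map_def by (rule induced_coset [OF W_descends]) auto

lemma w_map_pure: "w_map (pure XT (x, t)) = W x t +o TX"
  by (simp add: pure_def w_map_coset)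

text \<open>Since \<open>phi r = phi r * 1\<close>, balancedness moves \<open>r\<close> to
  \<open>x\<close> and leaves the unit, so \<open>W_one\<close> covers all values of
  \<open>phi\<close>.\<close>

lemma W_unit: "W x (phi r) +o TX = frag_of (1, rX r x) +o TX"
  using W_balanced [of r x 1] W_one [of "rX r x"] by simp

text \<open>The axioms concern arbitrary tensors and nested uses of \<open>induced\<close>. Once
  each map in them is shown to descend, both sides are sums over one representative
  \<open>p\<close>, and a law of \<open>W\<close> is applied to each summand.\<close>

lemma transposition_map_w_map: "transposition_map scale_R scale_T phi lX rX w_map"
proof (unfold_locales, fold XT_def TX_def)
  fix c assume "c \<in> quot UNIV XT"
  then show "w_map c \<in> quot UNIV TX"
    by (auto simp: quot_def w_map_coset)
next
  fix c c' assume "c \<in> quot UNIV XT" "c' \<in> quot UNIV XT"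
  then show "w_map (c + c') = w_map c + w_map c'"
    by (auto elim!: quot_cosetE simp: coset_add w_map_coset frag_extend_add)
next
  fix c r assume "c \<in> quot UNIV XT"
  then obtain p where c: "c = p +o XT" by (rule quot_cosetE)
  have "descends XT XT (\<lambda>(x, t). frag_of (lX r x, t))"
    unfolding XT_def
    by (rule descends_tens2, fold XT_def)
      (simp_all add: X.act_add_right XT_add_left XT_add_right XT_balanced X.left_right)
  then have "induced XT (\<lambda>(x, t). pure XT (lX r x, t)) c =
      frag_extend (\<lambda>(x, t). frag_of (lX r x, t)) p +o XT"
    unfolding c by (rule induced_coset) (auto simp: pure_def)
  moreover have "induced TX (\<lambda>(t, x). pure TX (phi r * t, x)) (w_map c) =
      frag_extend (\<lambda>(t, x). frag_of (phi r * t, x)) (frag_extend (\<lambda>(x, t). W x t) p) +o TX"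
    unfolding c w_map_coset
    by (rule induced_coset [OF phi_mult_left_descends]) (auto simp: pure_def)
  ultimately show "w_map (induced XT (\<lambda>(x, t). pure XT (lX r x, t)) c) =
      induced TX (\<lambda>(t, x). pure TX (phi r * t, x)) (w_map c)"
    by (auto simp: w_map_coset frag_extend_frag_extend W_left intro!: frag_extend_coset_cong)
next
  fix c r assume "c \<in> quot UNIV XT"
  then obtain p where c: "c = p +o XT" by (rule quot_cosetE)
  have "descends XT XT (\<lambda>(x, t). frag_of (x, t * phi r))"
    unfolding XT_def
    by (rule descends_tens2, fold XT_def)
      (simp_all add: distrib_right XT_add_left XT_add_right XT_balanced mult.assoc)
  then have "induced XT (\<lambda>(x, t). pure XT (x, t * phi r)) c =
      frag_extend (\<lambda>(x, t). frag_of (x, t * phi r)) p +o XT"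
    unfolding c by (rule induced_coset) (auto simp: pure_def)
  moreover have "induced TX (\<lambda>(t, x). pure TX (t, rX r x)) (w_map c) =
      frag_extend (\<lambda>(t, x). frag_of (t, rX r x)) (frag_extend (\<lambda>(x, t). W x t) p) +o TX"
    unfolding c w_map_coset
    by (rule induced_coset [OF right_act_descends]) (auto simp: pure_def)
  ultimately show "w_map (induced XT (\<lambda>(x, t). pure XT (x, t * phi r)) c) =
      induced TX (\<lambda>(t, x). pure TX (t, rX r x)) (w_map c)"
    by (auto simp: w_map_coset frag_extend_frag_extend W_right intro!: frag_extend_coset_cong)
next
  define XR where "XR = tens2 rX ((*) :: 'r \<Rightarrow> 'r \<Rightarrow> 'r)"
  define RX where "RX = tens2 (\<lambda>r s :: 'r. s * r) lX"
  have [simp]: "is_subgroup XR" "is_subgroup RX" by (simp_all add: XR_def RX_def)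
  fix u assume "u \<in> quot UNIV XR"
  then obtain p where u: "u = p +o XR" by (rule quot_cosetE)
  have "descends XR XT (\<lambda>(x, r). frag_of (x, phi r))"
    unfolding XR_def
    by (rule descends_tens2) (simp_all add: map_add map_mult XT_add_left XT_add_right XT_balanced)
  then have 1: "induced XT (\<lambda>(x, r). pure XT (x, phi r)) u = frag_extend (\<lambda>(x, r). frag_of (x, phi r)) p +o XT"
    unfolding u by (rule induced_coset) (auto simp: pure_def)
  have "descends XR RX (\<lambda>(x, r). frag_of (1, rX r x))"
    unfolding XR_def RX_def
    by (rule descends_tens2)
      (simp_all add: X.right_add_right X.right_add_left X.right_right tens2_add_right)
  then have 2: "induced RX (\<lambda>(x, r). pure RX (1, rX r x)) u =
      frag_extend (\<lambda>(x, r). frag_of (1, rX r x)) p +o RX"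
    unfolding u by (rule induced_coset) (auto simp: pure_def)
  have "descends RX TX (\<lambda>(r, x). frag_of (phi r, x))"
    unfolding RX_def
    by (rule descends_tens2) (simp_all add: map_add map_mult TX_add_left TX_add_right TX_balanced)
  then have "induced TX (\<lambda>(r, x). pure TX (phi r, x)) (q +o RX) =
      frag_extend (\<lambda>(r, x). frag_of (phi r, x)) q +o TX" for q
    by (rule induced_coset) (auto simp: pure_def)
  then show "w_map (induced XT (\<lambda>(x, r). pure XT (x, phi r)) u) =
      induced TX (\<lambda>(r, x). pure TX (phi r, x)) (induced RX (\<lambda>(x, r). pure RX (1, rX r x)) u)"
    by (auto simp: 1 2 w_map_coset frag_extend_frag_extend W_unit map_one intro!: frag_extend_coset_cong)
next
  define XTT where "XTT = tens3 rX (\<lambda>r t. phi r * t) (\<lambda>r t. t * phi r) (\<lambda>r t. phi r * t)"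
  define TXT where "TXT = tens3 (\<lambda>r t. t * phi r) lX rX (\<lambda>r t. phi r * t)"
  define TTX where "TTX = tens3 (\<lambda>r t. t * phi r) (\<lambda>r t. phi r * t) (\<lambda>r t. t * phi r) lX"
  have sub [simp]: "is_subgroup XTT" "is_subgroup TXT" "is_subgroup TTX"
    by (simp_all add: XTT_def TXT_def TTX_def)
  have TXT:
    "frag_of (t + t', x, s) +o TXT = (frag_of (t, x, s) + frag_of (t', x, s)) +o TXT"
    "frag_of (t, x + x', s) +o TXT = (frag_of (t, x, s) + frag_of (t, x', s)) +o TXT"
    "frag_of (t, x, s + s') +o TXT = (frag_of (t, x, s) + frag_of (t, x, s')) +o TXT"
    "frag_of (t * phi r, x, s) +o TXT = frag_of (t, lX r x, s) +o TXT"
    "frag_of (t, rX r x, s) +o TXT = frag_of (t, x, phi r * s) +o TXT" for t t' x x' s s' r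
    unfolding TXT_def
    by (rule tens3_add_left tens3_add_middle tens3_add_right tens3_balanced_left
        tens3_balanced_right [where lC = "\<lambda>r t. phi r * t"])+
  have TTX:
    "frag_of (t + t', s, x) +o TTX = (frag_of (t, s, x) + frag_of (t', s, x)) +o TTX"
    "frag_of (t, s + s', x) +o TTX = (frag_of (t, s, x) + frag_of (t, s', x)) +o TTX"
    "frag_of (t, s, x + x') +o TTX = (frag_of (t, s, x) + frag_of (t, s, x')) +o TTX"
    "frag_of (t * phi r, s, x) +o TTX = frag_of (t, phi r * s, x) +o TTX"
    "frag_of (t, s * phi r, x) +o TTX = frag_of (t, s, lX r x) +o TTX" for t t' x x' s s' r
    unfolding TTX_def
    by (rule tens3_add_left tens3_add_middle tens3_add_right
        tens3_balanced_left [where lB = "\<lambda>r t. phi r * t"]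
        tens3_balanced_right [where rB = "\<lambda>r t. t * phi r"])+
  \<comment> \<open>\<open>in1\<close> and \<open>in2\<close> fix an outer factor and carry the laws
    of \<open>W\<close> from \<open>TX\<close> into the threefold products; \<open>out1\<close> and
    \<open>out2\<close> let all three factors vary.\<close>
  have in1: "descends TX TXT (\<lambda>(s, y). frag_of (s, y, t'))" for t'
    unfolding TX_def by (rule descends_tens2) (simp_all add: TXT)
  have in2: "descends TX TTX (\<lambda>(s, y). frag_of (t, s, y))" for t
    unfolding TX_def by (rule descends_tens2) (simp_all add: TTX)
  note W1 = descends_coset [OF in1 subgroup_TX sub(2)]
  note W2 = descends_coset [OF in2 subgroup_TX sub(3)]
  have out1: "descends XTT TXT (\<lambda>(x, t, t'). frag_extend (\<lambda>(s, y). frag_of (s, y, t')) (W x t))"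
    unfolding XTT_def
  proof (rule descends_tens3; (simp only: prod.case)?)
    fix x t t' r
    \<comment> \<open>Balancedness between \<open>t\<close> and \<open>t'\<close> rests on right
      linearity: \<open>r\<close> passes to the right of \<open>y\<close> and from there to
      \<open>t'\<close>.\<close>
    have "frag_extend (\<lambda>(s, y). frag_of (s, y, t')) (W x (t * phi r)) +o TXT =
        frag_extend (\<lambda>(s, y). frag_of (s, rX r y, t')) (W x t) +o TXT"
      using W1 [OF W_right, of t' x t r] by (simp add: frag_extend_frag_extend split_def)
    also have "\<dots> = frag_extend (\<lambda>(s, y). frag_of (s, y, phi r * t')) (W x t) +o TXT"
      by (rule frag_extend_coset_cong) (auto simp: TXT)
    finally show "frag_extend (\<lambda>(s, y). frag_of (s, y, t')) (W x (t * phi r)) +o TXT =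
        frag_extend (\<lambda>(s, y). frag_of (s, y, phi r * t')) (W x t) +o TXT" .
  next
    fix x t and s s' :: 't
    show "frag_extend (\<lambda>(t', y). frag_of (t', y, s + s')) (W x t) +o TXT =
        (frag_extend (\<lambda>(t', y). frag_of (t', y, s)) (W x t) +
         frag_extend (\<lambda>(t', y). frag_of (t', y, s')) (W x t)) +o TXT"
      by (auto simp: TXT intro!: frag_extend_coset_cong simp flip: frag_extend_add_fun)
  qed (simp_all add: W1 [OF W_add_left] W1 [OF W_add_right] W1 [OF W_balanced] flip: frag_extend_add)
  have out2: "descends TXT TTX (\<lambda>(t, x, t'). frag_extend (\<lambda>(s, y). frag_of (t, s, y)) (W x t'))"
    unfolding TXT_def
  proof (rule descends_tens3; (simp only: prod.case)?)
    fix x t t' r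
    \<comment> \<open>Dually, left linearity turns the action on \<open>x\<close> into a left
      multiplication of \<open>s\<close>, whence \<open>r\<close> passes to
      \<open>t\<close>.\<close>
    have "frag_extend (\<lambda>(s, y). frag_of (t, s, y)) (W (lX r x) t') +o TTX =
        frag_extend (\<lambda>(s, y). frag_of (t, phi r * s, y)) (W x t') +o TTX"
      using W2 [OF W_left, of t r x t'] by (simp add: frag_extend_frag_extend split_def)
    also have "\<dots> = frag_extend (\<lambda>(s, y). frag_of (t * phi r, s, y)) (W x t') +o TTX"
      by (rule frag_extend_coset_cong) (auto simp: TTX)
    finally show "frag_extend (\<lambda>(s, y). frag_of (t * phi r, s, y)) (W x t') +o TTX =
        frag_extend (\<lambda>(s, y). frag_of (t, s, y)) (W (lX r x) t') +o TTX" by simp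
  next
    fix t t' x s
    show "frag_extend (\<lambda>(s', y). frag_of (t + t', s', y)) (W x s) +o TTX =
        (frag_extend (\<lambda>(s', y). frag_of (t, s', y)) (W x s) +
         frag_extend (\<lambda>(s', y). frag_of (t', s', y)) (W x s)) +o TTX"
      by (auto simp: TTX intro!: frag_extend_coset_cong simp flip: frag_extend_add_fun)
  qed (simp_all add: W2 [OF W_add_left] W2 [OF W_add_right] W2 [OF W_balanced] flip: frag_extend_add)
  fix v assume "v \<in> quot UNIV XTT"
  then obtain p where v: "v = p +o XTT" by (rule quot_cosetE)
  have "descends XTT XT (\<lambda>(x, t, t'). frag_of (x, t * t'))"
    unfolding XTT_def
    by (rule descends_tens3)
      (simp_all add: distrib_left distrib_right XT_add_left XT_add_right XT_balanced mult.assoc)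
  then have 1: "induced XT (\<lambda>(x, t, t'). pure XT (x, t * t')) v =
      frag_extend (\<lambda>(x, t, t'). frag_of (x, t * t')) p +o XT"
    unfolding v by (rule induced_coset) (auto simp: pure_def)
  \<comment> \<open>\<open>TX_balanced\<close> is supplied in the bracketing that
    \<open>mult.assoc\<close> produces, since the rewriting would otherwise destroy its left-hand
    side.\<close>
  have "descends TTX TX (\<lambda>(t, t', x). frag_of (t * t', x))"
    unfolding TTX_def
    by (rule descends_tens3)
      (simp_all add: distrib_left distrib_right TX_add_left TX_add_right mult.assoc
        TX_balanced [of "t * t'" for t t', unfolded mult.assoc])
  then have 2: "induced TX (\<lambda>(t, t', x). pure TX (t * t', x)) (q +o TTX) =
      frag_extend (\<lambda>(t, t', x). frag_of (t * t', x)) q +o TX" for q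
    by (rule induced_coset) (auto simp: pure_def)
  have "induced TXT (\<lambda>(s, y). pure TXT (s, y, t')) (q +o TX) =
      frag_extend (\<lambda>(s, y). frag_of (s, y, t')) q +o TXT" for t' q
    by (rule induced_coset [OF in1]) (auto simp: pure_def)
  then have 3: "induced TXT (\<lambda>(x, t, t'). induced TXT (\<lambda>(s, y). pure TXT (s, y, t')) (w_map (pure XT (x, t)))) v =
      frag_extend (\<lambda>(x, t, t'). frag_extend (\<lambda>(s, y). frag_of (s, y, t')) (W x t)) p +o TXT"
    unfolding v by (intro induced_coset [OF out1]) (auto simp: w_map_pure)
  have "induced TTX (\<lambda>(s, y). pure TTX (t, s, y)) (q +o TX) =
      frag_extend (\<lambda>(s, y). frag_of (t, s, y)) q +o TTX" for t q
    by (rule induced_coset [OF in2]) (auto simp: pure_def)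
  then have 4: "induced TTX (\<lambda>(t, x, t'). induced TTX (\<lambda>(s, y). pure TTX (t, s, y)) (w_map (pure XT (x, t')))) (q +o TXT) =
      frag_extend (\<lambda>(t, x, t'). frag_extend (\<lambda>(s, y). frag_of (t, s, y)) (W x t')) q +o TTX" for q
    by (intro induced_coset [OF out2]) (auto simp: w_map_pure)
  show "w_map (induced XT (\<lambda>(x, t, t'). pure XT (x, t * t')) v) =
      induced TX (\<lambda>(t, t', x). pure TX (t * t', x))
        (induced TTX (\<lambda>(t, x, t'). induced TTX (\<lambda>(t'', y). pure TTX (t, t'', y)) (w_map (pure XT (x, t'))))
          (induced TXT (\<lambda>(x, t, t'). induced TXT (\<lambda>(t'', y). pure TXT (t'', y, t')) (w_map (pure XT (x, t)))) v))"
    unfolding 1 2 3 4 w_map_coset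
    by (auto simp: frag_extend_frag_extend W_mult split_def intro!: frag_extend_coset_cong)
qed

section \<open>Representatives of the operations on the cyclic tensor powers\<close>

abbreviation C :: "nat \<Rightarrow> ('t list \<times> 'x \<Rightarrow>\<^sub>0 int) set"
  where "C \<equiv> cyc_rel phi lX rX"

lemmas C_add = cyc_add [where phi = phi and lX = lX and rX = rX]
  and C_add_right = cyc_add_right [where phi = phi and lX = lX and rX = rX]
  and C_balanced = cyc_balanced [where phi = phi and lX = lX and rX = rX]
  and C_balanced_end = cyc_balanced_end [where phi = phi and lX = lX and rX = rX]
  and C_cyclic = cyc_cyclic [where phi = phi and lX = lX and rX = rX]

text \<open>A scalar acts on \<open>T\<close> as the image of an element of \<open>R\<close>, from
  either side. Moving scalars between tensor factors thus becomes an instance of the relations for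
  \<open>R\<close>.\<close>

lemma phi_scale: "phi (scale_R k 1) * t = scale_T k t" "t * phi (scale_R k 1) = scale_T k t"
  by (simp_all add: map_scale map_one B.scale_mult_left B.scale_mult_right)

definition coface_rep :: "nat \<Rightarrow> 't list \<times> 'x \<Rightarrow> ('t list \<times> 'x \<Rightarrow>\<^sub>0 int)"
  where "coface_rep k = (\<lambda>(ts, x). frag_of (insert_one k ts, x))"

definition codegeneracy_rep :: "nat \<Rightarrow> 't list \<times> 'x \<Rightarrow> ('t list \<times> 'x \<Rightarrow>\<^sub>0 int)"
  where "codegeneracy_rep k = (\<lambda>(ts, x). frag_of (mult_at k ts, x))"

definition scale_rep :: "'k \<Rightarrow> 't list \<times> 'x \<Rightarrow> ('t list \<times> 'x \<Rightarrow>\<^sub>0 int)"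
  where "scale_rep k = (\<lambda>(ts, x). frag_of (ts[0 := scale_T k (ts ! 0)], x))"

definition cyclic_rep :: "'t list \<times> 'x \<Rightarrow> ('t list \<times> 'x \<Rightarrow>\<^sub>0 int)"
  where "cyclic_rep = (\<lambda>(ts, x). frag_extend (\<lambda>(s, y). frag_of (tl ts @ [s], y)) (W x (hd ts)))"

lemma scale_rep_descends: "descends (C n) (C n) (scale_rep k)"
proof (rule descends_cyc_rel; (simp only: scale_rep_def prod.case)?)
  fix us vs :: "'t list" and a b :: 't and x :: 'x assume "length us + length vs = n"
  then show "frag_of ((us @ (a + b) # vs)[0 := scale_T k ((us @ (a + b) # vs) ! 0)], x) +o C n =
      (frag_of ((us @ a # vs)[0 := scale_T k ((us @ a # vs) ! 0)], x) +
       frag_of ((us @ b # vs)[0 := scale_T k ((us @ b # vs) ! 0)], x)) +o C n"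
    using C_add [of us vs n "if us = [] then scale_T k a else a" "if us = [] then scale_T k b else b"]
      C_add [of "us[0 := scale_T k (us ! 0)]" vs n a b]
    by (cases us) (auto simp: B.act_add_right)
next
  fix ts :: "'t list" and x y :: 'x assume "length ts = Suc n"
  then show "frag_of (ts[0 := scale_T k (ts ! 0)], x + y) +o C n =
      (frag_of (ts[0 := scale_T k (ts ! 0)], x) + frag_of (ts[0 := scale_T k (ts ! 0)], y)) +o C n"
    by (simp add: C_add_right)
next
  fix us vs :: "'t list" and a b :: 't and r :: 'r and x :: 'x assume "length us + length vs + 1 = n"
  then show "frag_of ((us @ (a * phi r) # b # vs)[0 := scale_T k ((us @ (a * phi r) # b # vs) ! 0)], x) +o C n =
      frag_of ((us @ a # (phi r * b) # vs)[0 := scale_T k ((us @ a # (phi r * b) # vs) ! 0)], x) +o C n"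
    using C_balanced [of us vs n "scale_T k a"] C_balanced [of "us[0 := scale_T k (us ! 0)]" vs n]
    by (cases us) (auto simp flip: B.scale_mult_left)
next
  fix us :: "'t list" and a :: 't and r :: 'r and x :: 'x assume "length us = n"
  then show "frag_of ((us @ [a * phi r])[0 := scale_T k ((us @ [a * phi r]) ! 0)], x) +o C n =
      frag_of ((us @ [a])[0 := scale_T k ((us @ [a]) ! 0)], lX r x) +o C n"
    using C_balanced_end [of us n "scale_T k a"] C_balanced_end [of "us[0 := scale_T k (us ! 0)]" n a]
    by (cases us) (auto simp flip: B.scale_mult_left)
next
  fix ts :: "'t list" and a :: 't and r :: 'r and x :: 'x assume "length ts = n"
  then show "frag_of ((phi r * a # ts)[0 := scale_T k ((phi r * a # ts) ! 0)], x) +o C n =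
      frag_of ((a # ts)[0 := scale_T k ((a # ts) ! 0)], rX r x) +o C n"
    using C_cyclic [of ts n r "scale_T k a" x] by (simp add: B.scale_mult_right)
qed simp

text \<open>The delicate case is a unit inserted between the two factors of a relation. Then
  \<open>r\<close> is carried through it in two steps, because \<open>phi r * 1 = 1 * phi r\<close>.
  This happens between two factors in \<open>T\<close>, before \<open>X\<close> when
  \<open>k = Suc n\<close>, and at the front when \<open>k = 0\<close>, where the second step is the
  cyclic relation.\<close>

lemma coface_rep_descends:
  assumes k: "k \<le> Suc n"
  shows "descends (C n) (C (Suc n)) (coface_rep k)"
proof (rule descends_cyc_rel; (simp only: coface_rep_def prod.case)?)
  fix us vs :: "'t list" and a b :: 't and x :: 'x assume len: "length us + length vs = n"
  show "frag_of (insert_one k (us @ (a + b) # vs), x) +o C (Suc n) =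
      (frag_of (insert_one k (us @ a # vs), x) + frag_of (insert_one k (us @ b # vs), x)) +o C (Suc n)"
  proof (cases "k \<le> length us")
    case True
    then show ?thesis using len C_add [of "insert_one k us" vs "Suc n"]
      by (simp add: insert_one_append)
  next
    case False
    then obtain j where "k - length us = Suc j" by (cases "k - length us") auto
    with False show ?thesis using len C_add [of us "insert_one j vs" "Suc n"]
      by (simp add: insert_one_append)
  qed
next
  fix ts :: "'t list" and x y :: 'x assume "length ts = Suc n"
  then show "frag_of (insert_one k ts, x + y) +o C (Suc n) =
      (frag_of (insert_one k ts, x) + frag_of (insert_one k ts, y)) +o C (Suc n)"
    by (simp add: C_add_right)
next
  fix us vs :: "'t list" and a b :: 't and r :: 'r and x :: 'x assume len: "length us + length vs + 1 = n"
  consider "k \<le> length us" | "k = Suc (length us)" | "Suc (length us) < k"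
    by linarith
  then show "frag_of (insert_one k (us @ (a * phi r) # b # vs), x) +o C (Suc n) =
      frag_of (insert_one k (us @ a # (phi r * b) # vs), x) +o C (Suc n)"
  proof cases
    case 1
    then show ?thesis using len C_balanced [of "insert_one k us" vs "Suc n"]
      by (simp add: insert_one_append)
  next
    case 2
    have "frag_of (us @ (a * phi r) # 1 # b # vs, x) +o C (Suc n) =
        frag_of ((us @ [a]) @ (1 * phi r) # b # vs, x) +o C (Suc n)"
      using len C_balanced [of us "b # vs" "Suc n" a r 1 x] by simp
    also have "\<dots> = frag_of ((us @ [a]) @ 1 # (phi r * b) # vs, x) +o C (Suc n)"
      using len by (intro C_balanced) simp
    finally show ?thesis using 2 by (simp add: insert_one_append)
  next
    case 3
    then obtain j where "k = Suc (Suc (length us + j))" by (auto dest: less_imp_Suc_add)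
    then show ?thesis using len C_balanced [of us "insert_one j vs" "Suc n"]
      by (simp add: insert_one_append)
  qed
next
  fix us :: "'t list" and a :: 't and r :: 'r and x :: 'x assume len: "length us = n"
  show "frag_of (insert_one k (us @ [a * phi r]), x) +o C (Suc n) =
      frag_of (insert_one k (us @ [a]), lX r x) +o C (Suc n)"
  proof (cases "k \<le> length us")
    case True
    then show ?thesis using len C_balanced_end [of "insert_one k us" "Suc n"]
      by (simp add: insert_one_append)
  next
    case False
    with k len have [simp]: "k = Suc n" by simp
    have "frag_of (us @ (a * phi r) # 1 # [], x) +o C (Suc n) =
        frag_of ((us @ [a]) @ [1 * phi r], x) +o C (Suc n)"
      using len C_balanced [of us "[]" "Suc n" a r 1 x] by simp
    also have "\<dots> = frag_of ((us @ [a]) @ [1], lX r x) +o C (Suc n)"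
      using len by (intro C_balanced_end) simp
    finally show ?thesis using len by (simp add: insert_one_append)
  qed
next
  fix ts :: "'t list" and a :: 't and r :: 'r and x :: 'x assume len: "length ts = n"
  show "frag_of (insert_one k (phi r * a # ts), x) +o C (Suc n) =
      frag_of (insert_one k (a # ts), rX r x) +o C (Suc n)"
  proof (cases k)
    case 0
    have "frag_of (1 # (phi r * a) # ts, x) +o C (Suc n) = frag_of (phi r * 1 # a # ts, x) +o C (Suc n)"
      using len C_balanced [of "[]" ts "Suc n" 1 r a x] by simp
    also have "\<dots> = frag_of (1 # a # ts, rX r x) +o C (Suc n)"
      using len by (intro C_cyclic) simp
    finally show ?thesis using 0 by simp
  next
    case (Suc j)
    then show ?thesis using len C_cyclic [of "insert_one j ts" "Suc n"] by simp
  qed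
qed simp

text \<open>The cases give the position of the multiplied pair relative to the slots of the
  relation. Disjoint positions leave a relation of the same kind; an overlap is settled by
  distributivity or associativity. If the pair consists of the two balanced factors, both sides
  become the same list.\<close>

lemma codegeneracy_rep_descends:
  assumes k: "k \<le> n"
  shows "descends (C (Suc n)) (C n) (codegeneracy_rep k)"
proof (rule descends_cyc_rel; (simp only: codegeneracy_rep_def prod.case)?)
  fix us vs :: "'t list" and a b :: 't and x :: 'x assume len: "length us + length vs = Suc n"
  consider "Suc k < length us" | "Suc k = length us" | "k = length us" | "length us < k"
    by linarith
  then show "frag_of (mult_at k (us @ (a + b) # vs), x) +o C n =
      (frag_of (mult_at k (us @ a # vs), x) + frag_of (mult_at k (us @ b # vs), x)) +o C n"
  proof cases
    case 1
    then show ?thesis using len C_add [of "mult_at k us" vs n]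
      by (simp add: mult_at_append_left)
  next
    case 2
    then obtain us' c where us: "us = us' @ [c]" "length us' = k"
      by (metis length_append_singleton nat.inject length_Suc_conv_rev)
    then show ?thesis using len C_add [of us' vs n "c * a" "c * b"] mult_at_append_right [of us' 0]
      by (simp add: distrib_left)
  next
    case 3
    then obtain c vs' where "vs = c # vs'" using len k by (cases vs) auto
    with 3 show ?thesis using len C_add [of us vs' n "a * c" "b * c"] mult_at_append_right [of us 0]
      by (simp add: distrib_right)
  next
    case 4
    then obtain j where "k = length us + Suc j" by (auto dest: less_imp_Suc_add)
    then show ?thesis using len k C_add [of us "mult_at j vs" n]
      by (simp only: mult_at_append_right mult_at_Suc) simp
  qed
next
  fix ts :: "'t list" and x y :: 'x assume "length ts = Suc (Suc n)"
  then show "frag_of (mult_at k ts, x + y) +o C n =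
      (frag_of (mult_at k ts, x) + frag_of (mult_at k ts, y)) +o C n"
    using k by (simp add: C_add_right)
next
  fix us vs :: "'t list" and a b :: 't and r :: 'r and x :: 'x assume len: "length us + length vs + 1 = Suc n"
  consider "Suc k < length us" | "Suc k = length us" | "k = length us" | "k = Suc (length us)"
    | "Suc (length us) < k"
    by linarith
  then show "frag_of (mult_at k (us @ (a * phi r) # b # vs), x) +o C n =
      frag_of (mult_at k (us @ a # (phi r * b) # vs), x) +o C n"
  proof cases
    case 1
    then show ?thesis using len C_balanced [of "mult_at k us" vs n]
      by (simp add: mult_at_append_left)
  next
    case 2
    then obtain us' c where us: "us = us' @ [c]" "length us' = k"
      by (metis length_append_singleton nat.inject length_Suc_conv_rev)
    then show ?thesis using len C_balanced [of us' vs n "c * a"] mult_at_append_right [of us' 0]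
      by (simp add: mult.assoc)
  next
    case 3
    then show ?thesis using mult_at_append_right [of us 0] by (simp add: mult.assoc)
  next
    case 4
    then obtain c vs' where "vs = c # vs'" using len k by (cases vs) auto
    with 4 show ?thesis using len C_balanced [of us vs' n a r "b * c"] mult_at_append_right [of us 1]
      by (simp add: mult.assoc)
  next
    case 5
    then obtain j where "k = length us + Suc (Suc j)" by (auto dest: less_imp_Suc_add)
    then show ?thesis using len k C_balanced [of us "mult_at j vs" n]
      by (simp only: mult_at_append_right mult_at_Suc) simp
  qed
next
  fix us :: "'t list" and a :: 't and r :: 'r and x :: 'x assume len: "length us = Suc n"
  show "frag_of (mult_at k (us @ [a * phi r]), x) +o C n =
      frag_of (mult_at k (us @ [a]), lX r x) +o C n"
  proof (cases "k < n")
    case True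
    then show ?thesis using len C_balanced_end [of "mult_at k us" n]
      by (simp add: mult_at_append_left)
  next
    case False
    with k have [simp]: "k = n" by simp
    obtain us' c where us: "us = us' @ [c]" "length us' = n"
      using len by (metis length_append_singleton nat.inject length_Suc_conv_rev)
    then show ?thesis using len C_balanced_end [of us' n "c * a"] mult_at_append_right [of us' 0]
      by (simp add: mult.assoc)
  qed
next
  fix ts :: "'t list" and a :: 't and r :: 'r and x :: 'x assume len: "length ts = Suc n"
  show "frag_of (mult_at k (phi r * a # ts), x) +o C n =
      frag_of (mult_at k (a # ts), rX r x) +o C n"
  proof (cases k)
    case 0
    obtain b ts' where "ts = b # ts'" using len by (cases ts) auto
    with 0 show ?thesis using len C_cyclic [of ts' n r "a * b"] by (simp add: mult.assoc)
  next
    case (Suc j)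
    then show ?thesis using k len C_cyclic [of "mult_at j ts" n] by simp
  qed
qed simp

text \<open>Behind a fixed list, the last factor in \<open>T\<close> and the factor in
  \<open>X\<close> form a copy of \<open>TX\<close>. The laws of \<open>W\<close> enter the cyclic
  tensor product through this map.\<close>

lemma append_descends:
  assumes "length ts = n"
  shows "descends TX (C n) (\<lambda>(s, y). frag_of (ts @ [s], y))"
  unfolding TX_def using assms
  by (intro descends_tens2) (simp_all add: C_add C_add_right C_balanced_end)

lemma append_coset:
  "length ts = n \<Longrightarrow> p +o TX = q +o TX \<Longrightarrow>
    frag_extend (\<lambda>(s, y). frag_of (ts @ [s], y)) p +o C n =
    frag_extend (\<lambda>(s, y). frag_of (ts @ [s], y)) q +o C n"
  by (rule descends_coset [OF append_descends]) auto

text \<open>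
  \<open>W_right\<close> turns the right multiplication by \<open>phi r\<close> into a right action on the last factor, and
  the cyclic relation moves that action to the first factor.
\<close>

lemma append_cyclic:
  assumes "length ts = n"
  shows "frag_extend (\<lambda>(s, y). frag_of (ts @ [s], y)) (W x (t * phi r)) +o C n =
    frag_extend (\<lambda>(s, y). frag_of (phi r * hd (ts @ [s]) # tl (ts @ [s]), y)) (W x t) +o C n"
proof -
  have "frag_extend (\<lambda>(s, y). frag_of (ts @ [s], y)) (W x (t * phi r)) +o C n =
      frag_extend (\<lambda>(s, y). frag_of (ts @ [s], rX r y)) (W x t) +o C n"
    using append_coset [OF assms W_right, of x t r] by (simp add: frag_extend_frag_extend split_def)
  also have "\<dots> = frag_extend (\<lambda>(s, y). frag_of (phi r * hd (ts @ [s]) # tl (ts @ [s]), y)) (W x t) +o C n"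
    using assms by (intro frag_extend_coset_cong) (auto simp: C_cyclic)
  finally show ?thesis .
qed

text \<open>A relation among \<open>t_1, ..., t_n\<close> is merely shifted one place to the left.
  The relation between \<open>t_n\<close> and \<open>X\<close> becomes balancing against the new
  last factor followed by \<open>W_left\<close>; the one between \<open>X\<close> and
  \<open>t_0\<close> is \<open>W_balanced\<close>; the one between \<open>t_0\<close> and
  \<open>t_1\<close> is \<open>append_cyclic\<close>.\<close>

lemma cyclic_rep_descends: "descends (C n) (C n) cyclic_rep"
proof (rule descends_cyc_rel; (simp only: cyclic_rep_def prod.case)?)
  fix us vs :: "'t list" and a b :: 't and x :: 'x assume len: "length us + length vs = n"
  show "frag_extend (\<lambda>(s, y). frag_of (tl (us @ (a + b) # vs) @ [s], y)) (W x (hd (us @ (a + b) # vs))) +o C n =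
      (frag_extend (\<lambda>(s, y). frag_of (tl (us @ a # vs) @ [s], y)) (W x (hd (us @ a # vs))) +
       frag_extend (\<lambda>(s, y). frag_of (tl (us @ b # vs) @ [s], y)) (W x (hd (us @ b # vs)))) +o C n"
  proof (cases us)
    case Nil
    then show ?thesis using append_coset [of vs n, OF _ W_add_right [of x a b]] len
      by (simp add: frag_extend_add)
  next
    case (Cons c us')
    then show ?thesis using len C_add [of us' "vs @ [_]" n a b]
      by (auto simp flip: frag_extend_add_fun intro!: frag_extend_coset_cong)
  qed
next
  fix ts :: "'t list" and x y :: 'x assume "length ts = Suc n"
  then show "frag_extend (\<lambda>(s, y). frag_of (tl ts @ [s], y)) (W (x + y) (hd ts)) +o C n =
      (frag_extend (\<lambda>(s, y). frag_of (tl ts @ [s], y)) (W x (hd ts)) +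
       frag_extend (\<lambda>(s, y). frag_of (tl ts @ [s], y)) (W y (hd ts))) +o C n"
    using append_coset [of "tl ts" n, OF _ W_add_left [of x y "hd ts"]] by (simp add: frag_extend_add)
next
  fix us vs :: "'t list" and a b :: 't and r :: 'r and x :: 'x assume len: "length us + length vs + 1 = n"
  show "frag_extend (\<lambda>(s, y). frag_of (tl (us @ (a * phi r) # b # vs) @ [s], y)) (W x (hd (us @ (a * phi r) # b # vs))) +o C n =
      frag_extend (\<lambda>(s, y). frag_of (tl (us @ a # (phi r * b) # vs) @ [s], y)) (W x (hd (us @ a # (phi r * b) # vs))) +o C n"
  proof (cases us)
    case Nil
    then show ?thesis using append_cyclic [of "b # vs" n x a r] len by simp
  next
    case (Cons c us')
    then show ?thesis using len C_balanced [of us' "vs @ [_]" n a r b]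
      by (auto intro!: frag_extend_coset_cong)
  qed
next
  fix us :: "'t list" and a :: 't and r :: 'r and x :: 'x assume len: "length us = n"
  show "frag_extend (\<lambda>(s, y). frag_of (tl (us @ [a * phi r]) @ [s], y)) (W x (hd (us @ [a * phi r]))) +o C n =
      frag_extend (\<lambda>(s, y). frag_of (tl (us @ [a]) @ [s], y)) (W (lX r x) (hd (us @ [a]))) +o C n"
  proof (cases us)
    case Nil
    \<comment> \<open>Here \<open>n = 0\<close>, and \<open>t_0\<close> is both first and last.
      \<open>append_cyclic\<close> and \<open>W_left\<close> bring the two sides to the same sum
      with \<open>phi r\<close> on the left of the new factor.\<close>
    then show ?thesis
      using append_cyclic [of "[]" n x a r] append_coset [of "[]" n, OF _ W_left [of r x a]] len
      by (simp add: frag_extend_frag_extend split_def)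
  next
    case (Cons c us')
    then have "frag_extend (\<lambda>(s, y). frag_of (us' @ [a * phi r] @ [s], y)) (W x c) +o C n =
        frag_extend (\<lambda>(s, y). frag_of (us' @ [a] @ [phi r * s], y)) (W x c) +o C n"
      using len C_balanced [of us' "[]" n a r] by (intro frag_extend_coset_cong) auto
    then show ?thesis
      using Cons append_coset [of "us' @ [a]" n, OF _ W_left [of r x c]] len
      by (simp add: frag_extend_frag_extend split_def)
  qed
next
  fix ts :: "'t list" and a :: 't and r :: 'r and x :: 'x assume "length ts = n"
  then show "frag_extend (\<lambda>(s, y). frag_of (tl (phi r * a # ts) @ [s], y)) (W x (hd (phi r * a # ts))) +o C n =
      frag_extend (\<lambda>(s, y). frag_of (tl (a # ts) @ [s], y)) (W (rX r x) (hd (a # ts))) +o C n"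
    using append_coset [of ts n, OF _ W_balanced [of r x a]] by simp
qed simp

section \<open>The operations on cosets and their identities\<close>

definition w_cyc :: "nat \<Rightarrow> ('t list \<times> 'x \<Rightarrow>\<^sub>0 int) set \<Rightarrow> ('t list \<times> 'x \<Rightarrow>\<^sub>0 int) set"
  where "w_cyc n = induced (C n) (\<lambda>a. cyclic_rep a +o C n)"

lemma w_cyc_coset: "w_cyc n (p +o C n) = frag_extend cyclic_rep p +o C n"
  unfolding w_cyc_def by (rule induced_coset [OF cyclic_rep_descends]) auto

lemma w_cyc_pure:
  "w_cyc n (pure (C n) (t # ts, x)) =
    frag_extend (\<lambda>(s, y). frag_of (ts @ [s], y)) (W x t) +o C n"
  by (simp add: pure_def w_cyc_coset cyclic_rep_def)

lemma cyc_scale_coset: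
  "cyc_scale scale_T phi lX rX n k (p +o C n) = frag_extend (scale_rep k) p +o C n"
  unfolding cyc_scale_def
  by (rule induced_coset [OF scale_rep_descends]) (auto simp: pure_def scale_rep_def)

lemma cyc_coface_coset:
  "k \<le> Suc n \<Longrightarrow>
    cyc_coface phi lX rX n k (p +o C n) = frag_extend (coface_rep k) p +o C (Suc n)"
  unfolding cyc_coface_def
  by (rule induced_coset [OF coface_rep_descends]) (auto simp: pure_def coface_rep_def insert_one_def)

lemma cyc_codegeneracy_coset:
  "k \<le> n \<Longrightarrow>
    cyc_codegeneracy phi lX rX n k (p +o C (Suc n)) = frag_extend (codegeneracy_rep k) p +o C n"
  unfolding cyc_codegeneracy_def
  by (rule induced_coset [OF codegeneracy_rep_descends]) (auto simp: pure_def codegeneracy_rep_def mult_at_def)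

text \<open>Scalars act on the first factor, which changes from \<open>t_0\<close> to
  \<open>t_1\<close> under the rotation. Writing the scalar as a right multiplication of
  \<open>t_0\<close> by \<open>phi (scale_R k 1)\<close> makes \<open>append_cyclic\<close>
  transport it.\<close>

lemma cyclic_rep_scale_rep:
  assumes "length ts = Suc n"
  shows "frag_extend cyclic_rep (scale_rep k (ts, x)) +o C n =
    frag_extend (scale_rep k) (cyclic_rep (ts, x)) +o C n"
proof -
  obtain t us where ts: "ts = t # us" and us: "length us = n" using assms by (cases ts) auto
  have "frag_extend (\<lambda>(s, y). frag_of (us @ [s], y)) (W x (scale_T k t)) +o C n =
      frag_extend (\<lambda>(s, y). frag_of (phi (scale_R k 1) * hd (us @ [s]) # tl (us @ [s]), y)) (W x t) +o C n"
    using append_cyclic [OF us, of x t "scale_R k 1"] by (simp only: phi_scale)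
  also have "\<dots> = frag_extend (\<lambda>(s, y). frag_of ((us @ [s])[0 := scale_T k ((us @ [s]) ! 0)], y)) (W x t) +o C n"
    by (cases us) (simp_all add: phi_scale)
  finally show ?thesis
    by (simp add: ts cyclic_rep_def scale_rep_def frag_extend_frag_extend split_def)
qed

lemma cyclic_rep_one:
  "length ts = Suc n \<Longrightarrow> cyclic_rep (1 # ts, x) +o C (Suc n) = frag_of (ts @ [1], x) +o C (Suc n)"
  using append_coset [of ts "Suc n", OF _ W_one [of x]] by (simp add: cyclic_rep_def)

lemma cyclic_rep_mult:
  "length ts = n \<Longrightarrow> cyclic_rep (t * t' # ts, x) +o C n =
    frag_extend (\<lambda>(s, y). frag_extend (\<lambda>(s', z). frag_of (ts @ [s * s'], z)) (W y t')) (W x t) +o C n"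
  using append_coset [of ts n, OF _ W_mult [of x t t']]
  by (simp add: cyclic_rep_def frag_extend_frag_extend split_def)

lemma keys_cyclic_rep: "a \<in> tuples n \<Longrightarrow> Poly_Mapping.keys (cyclic_rep a) \<subseteq> tuples n"
  unfolding cyclic_rep_def
  by (cases a) (auto simp: tuples_def intro!: keys_frag_extend_subset [OF subset_UNIV])

lemma linear_coset_maps:
  assumes "\<And>p. f (p +o C n) = frag_extend g p +o C m"
    and "\<And>a. a \<in> tuples n \<Longrightarrow> Poly_Mapping.keys (g a) \<subseteq> tuples m"
    and "\<And>k a. a \<in> tuples n \<Longrightarrow>
      frag_extend g (scale_rep k a) +o C m = frag_extend (scale_rep k) (g a) +o C m"
  shows "linear_on (cyc_carrier phi lX rX n) (cyc_scale scale_T phi lX rX n)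
    (cyc_carrier phi lX rX m) (cyc_scale scale_T phi lX rX m) f"
  unfolding cyc_carrier_def
  by (rule linear_on_cosets [where h = scale_rep and h' = scale_rep, OF is_subgroup_cyc_rel
        is_subgroup_cyc_rel assms(1) cyc_scale_coset cyc_scale_coset assms(2,3)])

text \<open>Common pattern of the identities: each side is a composite of two maps given by
  representatives, so agreement on lists of length \<open>Suc n\<close> suffices.\<close>

lemma coset_maps_cong:
  assumes "c \<in> cyc_carrier phi lX rX n"
    and "\<And>p. c = p +o C n \<Longrightarrow> u = frag_extend f (frag_extend g p) +o C m \<and> v = frag_extend f' (frag_extend g' p) +o C m"
    and "\<And>ts x. length ts = Suc n \<Longrightarrow>
      frag_extend f (g (ts, x)) +o C m = frag_extend f' (g' (ts, x)) +o C m"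
  shows "u = v"
proof -
  obtain p where p: "c = p +o C n" "Poly_Mapping.keys p \<subseteq> tuples n"
    using assms(1) unfolding cyc_carrier_def by (rule quot_cosetE)
  have "frag_extend f (frag_extend g p) +o C m = frag_extend f' (frag_extend g' p) +o C m"
    using p(2) assms(3) by (intro frag_extend_comp_coset_cong) (auto simp: tuples_def)
  then show ?thesis using assms(2) [OF p(1)] by simp
qed

lemma coset_maps_cong_right:
  assumes "c \<in> cyc_carrier phi lX rX n"
    and "\<And>p. c = p +o C n \<Longrightarrow> u = frag_extend f (frag_extend g p) +o C m \<and> v = frag_extend f' p +o C m"
    and "\<And>ts x. length ts = Suc n \<Longrightarrow>
      frag_extend f (g (ts, x)) +o C m = f' (ts, x) +o C m"
  shows "u = v"
  by (rule coset_maps_cong [OF assms(1), where f = f and g = g and f' = f' and g' = frag_of and m = m])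
    (use assms(2,3) in \<open>auto simp flip: frag_expansion\<close>)

text \<open>The cosimplicial identities hold for the underlying lists; the relations of the quotient
  enter through the scalar action.\<close>

lemma cosimplicial_module_cyc:
  "cosimplicial_module (cyc_carrier phi lX rX) (cyc_scale scale_T phi lX rX)
    (cyc_coface phi lX rX) (cyc_codegeneracy phi lX rX)"
proof (rule cosimplicial_module.intro)
  fix n
  show "module_on (cyc_carrier phi lX rX n) (cyc_scale scale_T phi lX rX n)"
    unfolding cyc_carrier_def
  proof (rule module_on_quot [where h = scale_rep])
    fix k l and a :: "'t list \<times> 'x" assume "a \<in> tuples n"
    then obtain t ts x where a: "a = (t # ts, x)" "length ts = n"
      by (cases a) (auto simp: tuples_def length_Suc_conv)
    show "Poly_Mapping.keys (scale_rep k a) \<subseteq> tuples n"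
      using a by (simp add: scale_rep_def tuples_def)
    show "scale_rep (k + l) a +o C n = (scale_rep k a + scale_rep l a) +o C n"
      using a C_add [of "[]" ts n "scale_T k t" "scale_T l t" x] by (simp add: scale_rep_def B.act_add_left)
    show "frag_extend (scale_rep k) (scale_rep l a) +o C n = scale_rep (k * l) a +o C n"
      using a by (simp add: scale_rep_def B.act_act)
    show "scale_rep 1 a +o C n = frag_of a +o C n"
      using a by (simp add: scale_rep_def B.act_one)
  qed (auto simp: cyc_scale_coset)
next
  fix k n :: nat assume k: "k \<le> Suc n"
  show "linear_on (cyc_carrier phi lX rX n) (cyc_scale scale_T phi lX rX n)
      (cyc_carrier phi lX rX (Suc n)) (cyc_scale scale_T phi lX rX (Suc n)) (cyc_coface phi lX rX n k)"
  proof (rule linear_coset_maps [OF cyc_coface_coset [OF k]])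
    fix l and a :: "'t list \<times> 'x" assume "a \<in> tuples n"
    then obtain t ts x where a: "a = (t # ts, x)" "length ts = n"
      by (cases a) (auto simp: tuples_def length_Suc_conv)
    show "Poly_Mapping.keys (coface_rep k a) \<subseteq> tuples (Suc n)"
      using a by (simp add: coface_rep_def tuples_def)
    show "frag_extend (coface_rep k) (scale_rep l a) +o C (Suc n) =
        frag_extend (scale_rep l) (coface_rep k a) +o C (Suc n)"
    proof (cases k)
      case 0
      \<comment> \<open>With the unit in front, the scaled factor is no longer \<open>t\<close>. The
        scalar, in the form \<open>phi (scale_R l 1)\<close>, crosses the first tensor sign.\<close>
      have "frag_of (1 # (phi (scale_R l 1) * t) # ts, x) +o C (Suc n) =
          frag_of ((1 * phi (scale_R l 1)) # t # ts, x) +o C (Suc n)"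
        using a C_balanced [of "[]" ts "Suc n" 1 "scale_R l 1" t x] by simp
      then show ?thesis using a 0
        by (simp add: phi_scale coface_rep_def scale_rep_def)
    next
      case (Suc j)
      then show ?thesis using a by (simp add: coface_rep_def scale_rep_def)
    qed
  qed
next
  fix k n :: nat assume k: "k \<le> n"
  show "linear_on (cyc_carrier phi lX rX (Suc n)) (cyc_scale scale_T phi lX rX (Suc n))
      (cyc_carrier phi lX rX n) (cyc_scale scale_T phi lX rX n) (cyc_codegeneracy phi lX rX n k)"
  proof (rule linear_coset_maps [OF cyc_codegeneracy_coset [OF k]])
    fix l and a :: "'t list \<times> 'x" assume "a \<in> tuples (Suc n)"
    then obtain t t' ts x where a: "a = (t # t' # ts, x)" "length ts = n"
      by (cases a) (auto simp: tuples_def length_Suc_conv)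
    show "Poly_Mapping.keys (codegeneracy_rep k a) \<subseteq> tuples n"
      using a k by (simp add: codegeneracy_rep_def tuples_def)
    show "frag_extend (codegeneracy_rep k) (scale_rep l a) +o C n =
        frag_extend (scale_rep l) (codegeneracy_rep k a) +o C n"
      using a by (cases k) (simp_all add: codegeneracy_rep_def scale_rep_def B.scale_mult_left)
  qed
next
  fix i j n :: nat and c assume ij: "i < j" "j \<le> Suc (Suc n)" and c: "c \<in> cyc_carrier phi lX rX n"
  show "cyc_coface phi lX rX (Suc n) j (cyc_coface phi lX rX n i c) =
      cyc_coface phi lX rX (Suc n) i (cyc_coface phi lX rX n (j - 1) c)"
    by (rule coset_maps_cong [OF c, where f = "coface_rep j" and g = "coface_rep i" and f' = "coface_rep i" and g' = "coface_rep (j - 1)" and m = "Suc (Suc n)"])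
      (use ij in \<open>simp_all add: cyc_coface_coset coface_rep_def insert_one_insert_one\<close>)
next
  fix i j n :: nat and c assume ij: "i \<le> j" "j \<le> n" and c: "c \<in> cyc_carrier phi lX rX (Suc (Suc n))"
  show "cyc_codegeneracy phi lX rX n j (cyc_codegeneracy phi lX rX (Suc n) i c) =
      cyc_codegeneracy phi lX rX n i (cyc_codegeneracy phi lX rX (Suc n) (Suc j) c)"
    by (rule coset_maps_cong [OF c, where f = "codegeneracy_rep j" and g = "codegeneracy_rep i" and f' = "codegeneracy_rep i" and g' = "codegeneracy_rep (Suc j)" and m = n])
      (use ij in \<open>simp_all add: cyc_codegeneracy_coset codegeneracy_rep_def mult_at_mult_at\<close>)
next
  fix i j n :: nat and c assume ij: "i < j" "j \<le> Suc n" and c: "c \<in> cyc_carrier phi lX rX (Suc n)"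
  show "cyc_codegeneracy phi lX rX (Suc n) j (cyc_coface phi lX rX (Suc n) i c) =
      cyc_coface phi lX rX n i (cyc_codegeneracy phi lX rX n (j - 1) c)"
    by (rule coset_maps_cong [OF c, where f = "codegeneracy_rep j" and g = "coface_rep i" and f' = "coface_rep i" and g' = "codegeneracy_rep (j - 1)" and m = "Suc n"])
      (use ij in \<open>simp_all add: cyc_codegeneracy_coset cyc_coface_coset codegeneracy_rep_def coface_rep_def mult_at_insert_one_less\<close>)
next
  fix i j n :: nat and c assume ij: "i = j \<or> i = Suc j" "j \<le> n" and c: "c \<in> cyc_carrier phi lX rX n"
  show "cyc_codegeneracy phi lX rX n j (cyc_coface phi lX rX n i c) = c"
    by (rule coset_maps_cong_right [OF c, where f = "codegeneracy_rep j" and g = "coface_rep i" and f' = frag_of and m = n])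
      (use ij in \<open>auto simp: cyc_codegeneracy_coset cyc_coface_coset codegeneracy_rep_def coface_rep_def
        mult_at_insert_one_eq frag_expansion [symmetric]\<close>)
next
  fix i j n :: nat and c assume ij: "Suc j < i" "i \<le> Suc (Suc n)" and c: "c \<in> cyc_carrier phi lX rX (Suc n)"
  show "cyc_codegeneracy phi lX rX (Suc n) j (cyc_coface phi lX rX (Suc n) i c) =
      cyc_coface phi lX rX n (i - 1) (cyc_codegeneracy phi lX rX n j c)"
    by (rule coset_maps_cong [OF c, where f = "codegeneracy_rep j" and g = "coface_rep i" and f' = "coface_rep (i - 1)" and g' = "codegeneracy_rep j" and m = "Suc n"])
      (use ij in \<open>simp_all add: cyc_codegeneracy_coset cyc_coface_coset codegeneracy_rep_def coface_rep_def mult_at_insert_one_greater\<close>)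
qed

text \<open>For \<open>k\<close> at least 1 the coface or codegeneracy avoids altering
  \<open>t_0\<close>, so the rotation only lowers its index. For \<open>k = 0\<close> it produces
  the factor on which \<open>W\<close> acts: the coface relation is then \<open>W_one\<close>, and
  the codegeneracy relation is \<open>W_mult\<close>.\<close>

lemma para_cocyclic_module_cyc:
  "para_cocyclic_module (cyc_carrier phi lX rX) (cyc_scale scale_T phi lX rX)
    (cyc_coface phi lX rX) (cyc_codegeneracy phi lX rX) w_cyc"
proof (intro para_cocyclic_module.intro cosimplicial_module_cyc para_cocyclic_module_axioms.intro)
  fix n
  show "linear_on (cyc_carrier phi lX rX n) (cyc_scale scale_T phi lX rX n)
      (cyc_carrier phi lX rX n) (cyc_scale scale_T phi lX rX n) (w_cyc n)"
    by (rule linear_coset_maps [OF w_cyc_coset keys_cyclic_rep])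
      (auto simp: tuples_def cyclic_rep_scale_rep)
next
  fix n c assume c: "c \<in> cyc_carrier phi lX rX n"
  show "w_cyc (Suc n) (cyc_coface phi lX rX n 0 c) = cyc_coface phi lX rX n (Suc n) c"
    by (rule coset_maps_cong_right [OF c, where f = cyclic_rep and g = "coface_rep 0" and f' = "coface_rep (Suc n)" and m = "Suc n"])
      (simp_all add: cyc_coface_coset w_cyc_coset coface_rep_def cyclic_rep_one insert_one_def)
next
  fix n k :: nat and c assume k: "1 \<le> k" "k \<le> Suc n" and c: "c \<in> cyc_carrier phi lX rX n"
  show "w_cyc (Suc n) (cyc_coface phi lX rX n k c) = cyc_coface phi lX rX n (k - 1) (w_cyc n c)"
  proof (rule coset_maps_cong [OF c])
    show "w_cyc (Suc n) (cyc_coface phi lX rX n k c) =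
        frag_extend cyclic_rep (frag_extend (coface_rep k) p) +o C (Suc n) \<and>
      cyc_coface phi lX rX n (k - 1) (w_cyc n c) =
        frag_extend (coface_rep (k - 1)) (frag_extend cyclic_rep p) +o C (Suc n)"
      if "c = p +o C n" for p
      using that k by (simp add: w_cyc_coset cyc_coface_coset)
    fix ts :: "'t list" and x assume "length ts = Suc n"
    then obtain t us where ts: "ts = t # us" and us: "length us = n" by (cases ts) auto
    obtain j where j: "k = Suc j" using k by (cases k) auto
    then show "frag_extend cyclic_rep (coface_rep k (ts, x)) +o C (Suc n) =
        frag_extend (coface_rep (k - 1)) (cyclic_rep (ts, x)) +o C (Suc n)"
      using k us
      by (simp add: ts cyclic_rep_def coface_rep_def frag_extend_frag_extend insert_one_append split_def)
  qed
next
  fix n c assume c: "c \<in> cyc_carrier phi lX rX (Suc n)"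
  show "w_cyc n (cyc_codegeneracy phi lX rX n 0 c) =
      cyc_codegeneracy phi lX rX n n (w_cyc (Suc n) (w_cyc (Suc n) c))"
  proof (rule coset_maps_cong [OF c])
    \<comment> \<open>The right-hand side composes three maps; the second rotation and the
      codegeneracy are merged to fit the two-map pattern.\<close>
    show "w_cyc n (cyc_codegeneracy phi lX rX n 0 c) =
        frag_extend cyclic_rep (frag_extend (codegeneracy_rep 0) p) +o C n \<and>
      cyc_codegeneracy phi lX rX n n (w_cyc (Suc n) (w_cyc (Suc n) c)) =
        frag_extend (\<lambda>a. frag_extend (codegeneracy_rep n) (cyclic_rep a)) (frag_extend cyclic_rep p) +o C n"
      if "c = p +o C (Suc n)" for p
      using that by (simp add: w_cyc_coset cyc_codegeneracy_coset frag_extend_frag_extend)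
    fix ts :: "'t list" and x assume "length ts = Suc (Suc n)"
    then obtain t t' us where ts: "ts = t # t' # us" and us: "length us = n" by (auto simp: length_Suc_conv)
    have "mult_at n (us @ [s, s']) = us @ [s * s']" for s s'
      using mult_at_append_right [of us 0 "[s, s']"] us by simp
    then show "frag_extend cyclic_rep (codegeneracy_rep 0 (ts, x)) +o C n =
        frag_extend (\<lambda>a. frag_extend (codegeneracy_rep n) (cyclic_rep a)) (cyclic_rep (ts, x)) +o C n"
      using us cyclic_rep_mult [OF us, of t t' x]
      by (simp add: ts codegeneracy_rep_def) (simp add: cyclic_rep_def frag_extend_frag_extend split_def)
  qed
next
  fix n k :: nat and c assume k: "1 \<le> k" "k \<le> n" and c: "c \<in> cyc_carrier phi lX rX (Suc n)"
  show "w_cyc n (cyc_codegeneracy phi lX rX n k c) =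
      cyc_codegeneracy phi lX rX n (k - 1) (w_cyc (Suc n) c)"
  proof (rule coset_maps_cong [OF c])
    show "w_cyc n (cyc_codegeneracy phi lX rX n k c) =
        frag_extend cyclic_rep (frag_extend (codegeneracy_rep k) p) +o C n \<and>
      cyc_codegeneracy phi lX rX n (k - 1) (w_cyc (Suc n) c) =
        frag_extend (codegeneracy_rep (k - 1)) (frag_extend cyclic_rep p) +o C n"
      if "c = p +o C (Suc n)" for p
      using that k by (simp add: w_cyc_coset cyc_codegeneracy_coset)
    fix ts :: "'t list" and x assume "length ts = Suc (Suc n)"
    then obtain t us where ts: "ts = t # us" and us: "length us = Suc n" by (cases ts) auto
    obtain j where j: "k = Suc j" using k by (cases k) auto
    then show "frag_extend cyclic_rep (codegeneracy_rep k (ts, x)) +o C n =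
        frag_extend (codegeneracy_rep (k - 1)) (cyclic_rep (ts, x)) +o C n"
      using k us
      by (simp add: ts cyclic_rep_def codegeneracy_rep_def frag_extend_frag_extend mult_at_append_left split_def)
  qed
qed

end

section \<open>Representatives of comultiplications and coactions\<close>

definition coset_rep :: "('a \<Rightarrow>\<^sub>0 int) set \<Rightarrow> ('a \<Rightarrow>\<^sub>0 int) set \<Rightarrow> 'a \<Rightarrow>\<^sub>0 int"
  where "coset_rep N c = (SOME p. c = p +o N)"

lemma coset_rep: "c \<in> quot UNIV N \<Longrightarrow> coset_rep N c +o N = c"
  unfolding coset_rep_def by (rule someI2_ex [of "\<lambda>p. c = p +o N"]) (auto simp: quot_def)

lemma frag_val_add_fun: "frag_val (\<lambda>a. f a + g a) p = frag_val f p + frag_val g p"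
  by (rule frag_induction [of p UNIV]) (auto simp: frag_val_diff)

lemma frag_extend_coset_cong_pair:
  assumes "is_subgroup N" and "\<And>a b. f (a, b) +o N = g (a, b) +o N"
  shows "frag_extend f p +o N = frag_extend g p +o N"
  using assms by (intro frag_extend_coset_cong) auto

section \<open>Comultiplication and counit of a bialgebroid on representatives\<close>

context left_bialgebroid
begin

lemma subgroup_BB [simp]: "is_subgroup BB" and subgroup_BBB [simp]: "is_subgroup BBB"
  by (simp_all add: BB_def BBB_def)

lemma BB_add_left: "frag_of (a + a', b) +o BB = (frag_of (a, b) + frag_of (a', b)) +o BB"
  and BB_add_right: "frag_of (a, b + b') +o BB = (frag_of (a, b) + frag_of (a, b')) +o BB"
  and BB_balanced: "frag_of (zeta r * a, b) +o BB = frag_of (a, xi r * b) +o BB"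
  unfolding BB_def lB_def rB_def
  by (rule tens2_add_left tens2_add_right
      tens2_balanced [where rA = "\<lambda>r b. zeta r * b" and lB = "\<lambda>r b. xi r * b"])+

lemma descends_BB:
  assumes "is_subgroup N"
    and "\<And>a a' b. f (a + a', b) +o N = (f (a, b) + f (a', b)) +o N"
    and "\<And>a b b'. f (a, b + b') +o N = (f (a, b) + f (a, b')) +o N"
    and "\<And>r a b. f (zeta r * a, b) +o N = f (a, xi r * b) +o N"
  shows "descends BB N f"
  unfolding BB_def lB_def rB_def by (rule descends_tens2) (rule assms)+

lemma descends_val_BB:
  assumes "\<And>a a' b. f (a + a', b) = f (a, b) + f (a', b)"
    and "\<And>a b b'. f (a, b + b') = f (a, b) + f (a, b')"
    and "\<And>r a b. f (zeta r * a, b) = f (a, xi r * b)"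
  shows "descends_val BB f"
  unfolding BB_def lB_def rB_def by (rule descends_val_tens2) (rule assms)+

definition D :: "'b \<Rightarrow> ('b \<times> 'b \<Rightarrow>\<^sub>0 int)"
  where "D b = coset_rep BB (Delta b)"

lemma D_coset: "D b +o BB = Delta b"
  unfolding D_def by (rule coset_rep [OF Delta_closed])

lemma induced_Delta:
  "\<lbrakk>descends BB N g; is_subgroup N; \<And>a. f a = g a +o N\<rbrakk> \<Longrightarrow>
    induced N f (Delta b) = frag_extend g (D b) +o N"
  using induced_coset [of BB N g f "D b"] by (simp add: D_coset)

lemma D_add: "D (b + b') +o BB = (D b + D b') +o BB"
  using Delta_add [of b b'] by (simp add: coset_add flip: D_coset)

lemma D_right: "D (zeta r * b) +o BB = frag_extend (\<lambda>(b1, b2). frag_of (b1, zeta r * b2)) (D b) +o BB"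
proof -
  have "descends BB BB (\<lambda>(b1, b2). frag_of (b1, zeta r * b2))"
    by (rule descends_BB)
      (simp_all add: distrib_left BB_add_left BB_add_right BB_balanced xi_zeta_commute flip: mult.assoc)
  then show ?thesis
    using Delta_right [of r b] unfolding rB_def D_coset
    by (subst (asm) induced_Delta) (auto simp: pure_def)
qed

text \<open>Left linearity of \<open>Delta\<close> applied to \<open>xi r = xi r * 1\<close> and the
  value at 1; the analogue for \<open>zeta\<close> uses right linearity.\<close>

lemma Delta_xi: "Delta (xi r) = pure BB (xi r, 1)"
proof -
  have "descends BB BB (\<lambda>(b1, b2). frag_of (xi r * b1, b2))"
    by (rule descends_BB)
      (simp_all add: distrib_left BB_add_left BB_add_right BB_balanced xi_zeta_commute flip: mult.assoc,
        simp add: xi_zeta_commute mult.assoc BB_balanced)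
  then show ?thesis
    using Delta_left [of r 1] induced_pure [of BB BB "\<lambda>(b1, b2). frag_of (xi r * b1, b2)"
        "\<lambda>(b1, b2). pure BB (xi r * b1, b2)" "(1, 1)"]
    by (simp add: lB_def Delta_one pure_def split_def)
qed

lemma Delta_zeta: "Delta (zeta r) = pure BB (1, zeta r)"
proof -
  have "descends BB BB (\<lambda>(b1, b2). frag_of (b1, zeta r * b2))"
    by (rule descends_BB)
      (simp_all add: distrib_left BB_add_left BB_add_right BB_balanced xi_zeta_commute flip: mult.assoc)
  then show ?thesis
    using Delta_right [of r 1] induced_pure [of BB BB "\<lambda>(b1, b2). frag_of (b1, zeta r * b2)"
        "\<lambda>(b1, b2). pure BB (b1, zeta r * b2)" "(1, 1)"]
    by (simp add: rB_def Delta_one pure_def split_def)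
qed

text \<open>The relations of \<open>BB\<close> balance left multiplications, which commute with
  right multiplications.\<close>

lemma right_mult_descends: "descends BB BB (\<lambda>(b1, b2). frag_of (b1 * c, b2 * c'))"
  by (rule descends_BB) (simp_all add: distrib_right BB_add_left BB_add_right BB_balanced mult.assoc)

lemma right_mult_coset:
  "p +o BB = q +o BB \<Longrightarrow>
    frag_extend (\<lambda>(b1, b2). frag_of (b1 * c, b2 * c')) p +o BB =
    frag_extend (\<lambda>(b1, b2). frag_of (b1 * c, b2 * c')) q +o BB"
  by (rule descends_coset [OF right_mult_descends]) auto

lemma D_takeuchi:
  "frag_extend (\<lambda>(b1, b2). frag_of (b1 * zeta r, b2)) (D b) +o BB =
   frag_extend (\<lambda>(b1, b2). frag_of (b1, b2 * xi r)) (D b) +o BB"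
  using takeuchi [of r b] right_mult_descends [of "zeta r" 1] right_mult_descends [of 1 "xi r"]
  by (subst (asm) (1 2) induced_Delta) (auto simp: pure_def)

text \<open>\<open>Delta_mult\<close> sums over \<open>Delta (xi r)\<close> outside and
  \<open>Delta b\<close> inside. Evaluating the outer sum at \<open>(xi r, 1)\<close> requires that
  the inner value, \<open>D b\<close> multiplied on the right by \<open>c\<close> and
  \<open>c'\<close>, is balanced in \<open>(c, c')\<close>; this is the Takeuchi condition.\<close>

lemma D_mult_xi:
  "D (b * xi r) +o BB = frag_extend (\<lambda>(b1, b2). frag_of (b1 * xi r, b2)) (D b) +o BB"
proof -
  let ?R = "\<lambda>(c, c'). frag_extend (\<lambda>(b1, b2). frag_of (b1 * c, b2 * c')) (D b)"
  have R: "induced BB (\<lambda>(b1, b2). pure BB (b1 * c, b2 * c')) (Delta b) = ?R (c, c') +o BB" for c c'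
    unfolding prod.case by (rule induced_Delta [OF right_mult_descends]) (auto simp: pure_def)
  have "descends BB BB ?R"
  proof (rule descends_BB; (simp only: prod.case)?)
    fix s c c'
    have "frag_extend (\<lambda>(b1, b2). frag_of (b1 * (zeta s * c), b2 * c')) (D b) +o BB =
        frag_extend (\<lambda>(b1, b2). frag_of (b1 * c, b2 * c'))
          (frag_extend (\<lambda>(b1, b2). frag_of (b1 * zeta s, b2)) (D b)) +o BB"
      by (simp add: frag_extend_frag_extend split_def mult.assoc)
    also have "\<dots> = frag_extend (\<lambda>(b1, b2). frag_of (b1 * c, b2 * c'))
          (frag_extend (\<lambda>(b1, b2). frag_of (b1, b2 * xi s)) (D b)) +o BB"
      by (rule right_mult_coset [OF D_takeuchi])
    also have "\<dots> = frag_extend (\<lambda>(b1, b2). frag_of (b1 * c, b2 * (xi s * c'))) (D b) +o BB"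
      by (simp add: frag_extend_frag_extend split_def mult.assoc)
    finally show "frag_extend (\<lambda>(b1, b2). frag_of (b1 * (zeta s * c), b2 * c')) (D b) +o BB =
        frag_extend (\<lambda>(b1, b2). frag_of (b1 * c, b2 * (xi s * c'))) (D b) +o BB" .
  next
    fix a a' c
    show "frag_extend (\<lambda>(b1, b2). frag_of (b1 * (a + a'), b2 * c)) (D b) +o BB =
        (frag_extend (\<lambda>(b1, b2). frag_of (b1 * a, b2 * c)) (D b) +
         frag_extend (\<lambda>(b1, b2). frag_of (b1 * a', b2 * c)) (D b)) +o BB"
      unfolding frag_extend_add_fun [symmetric]
      by (rule frag_extend_coset_cong) (auto simp: distrib_left BB_add_left)
  next
    fix a a' c
    show "frag_extend (\<lambda>(b1, b2). frag_of (b1 * c, b2 * (a + a'))) (D b) +o BB =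
        (frag_extend (\<lambda>(b1, b2). frag_of (b1 * c, b2 * a)) (D b) +
         frag_extend (\<lambda>(b1, b2). frag_of (b1 * c, b2 * a')) (D b)) +o BB"
      unfolding frag_extend_add_fun [symmetric]
      by (rule frag_extend_coset_cong) (auto simp: distrib_left BB_add_right)
  qed simp
  then have "Delta (b * xi r) = ?R (xi r, 1) +o BB"
    unfolding Delta_mult Delta_xi by (rule induced_pure) (auto simp: R)
  then show ?thesis by (simp add: D_coset)
qed

lemma xi_eps_descends: "descends_val BB (\<lambda>(b1, b2). xi (eps b1) * b2)"
  by (rule descends_val_BB)
    (use eps_right in \<open>simp_all add: rB_def eps_add map_add map_mult distrib_left distrib_right mult.assoc\<close>)

lemma zeta_eps_descends: "descends_val BB (\<lambda>(b1, b2). zeta (eps b2) * b1)"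
  by (rule descends_val_BB)
    (use eps_left in \<open>simp_all add: lB_def eps_add zeta_add zeta_mult distrib_left distrib_right mult.assoc\<close>)

lemma D_counit_left: "frag_val (\<lambda>(b1, b2). xi (eps b1) * b2) (D b) = b"
  using counit_left [of b] induced_val_coset [OF xi_eps_descends, of "D b"]
  by (simp add: D_coset lB_def)

lemma D_counit_right: "frag_val (\<lambda>(b1, b2). zeta (eps b2) * b1) (D b) = b"
  using counit_right [of b] induced_val_coset [OF zeta_eps_descends, of "D b"]
  by (simp add: D_coset rB_def)

text \<open>The left counit axiom at \<open>b * xi r\<close>, with its comultiplication taken from
  \<open>D_mult_xi\<close>.\<close>

lemma D_counit_left_xi: "frag_val (\<lambda>(b1, b2). xi (eps (b1 * xi r)) * b2) (D b) = b * xi r"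
proof -
  have "frag_val (\<lambda>(b1, b2). xi (eps b1) * b2) (D (b * xi r)) =
      frag_val (\<lambda>(b1, b2). xi (eps b1) * b2) (frag_extend (\<lambda>(b1, b2). frag_of (b1 * xi r, b2)) (D b))"
    by (rule descends_val_coset [OF xi_eps_descends _ D_mult_xi]) simp
  then show ?thesis
    using D_counit_left [of "b * xi r"] by (simp add: frag_val_frag_extend split_def)
qed

text \<open>The Takeuchi condition trades \<open>xi r\<close> behind the second factor for
  \<open>zeta r\<close> behind the first. What remains is the right counit axiom multiplied by
  \<open>zeta r\<close> on the right.\<close>

lemma D_counit_right_xi: "frag_val (\<lambda>(b1, b2). zeta (eps (b2 * xi r)) * b1) (D b) = b * zeta r"
proof -
  have "frag_val (\<lambda>(b1, b2). zeta (eps b2) * b1) (frag_extend (\<lambda>(b1, b2). frag_of (b1 * zeta r, b2)) (D b)) =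
      frag_val (\<lambda>(b1, b2). zeta (eps b2) * b1) (frag_extend (\<lambda>(b1, b2). frag_of (b1, b2 * xi r)) (D b))"
    by (rule descends_val_coset [OF zeta_eps_descends _ D_takeuchi]) simp
  moreover have "frag_val (\<lambda>(b1, b2). zeta (eps b2) * b1) (D b) * zeta r =
      frag_val (\<lambda>a. (case a of (b1, b2) \<Rightarrow> zeta (eps b2) * b1) * zeta r) (D b)"
    by (rule additive_frag_val) (rule distrib_right)
  ultimately show ?thesis
    using D_counit_right [of b] by (simp add: frag_val_frag_extend split_def mult.assoc)
qed

end

section \<open>The coaction on representatives and the right action it defines\<close>

context left_comodule
begin

lemma subgroup_BX [simp]: "is_subgroup BX" and subgroup_BBX [simp]: "is_subgroup BBX"
  by (simp_all add: BX_def BBX_def)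

lemma BX_add_left: "frag_of (b + b', x) +o BX = (frag_of (b, x) + frag_of (b', x)) +o BX"
  and BX_add_right: "frag_of (b, x + y) +o BX = (frag_of (b, x) + frag_of (b, y)) +o BX"
  and BX_balanced: "frag_of (zeta r * b, x) +o BX = frag_of (b, lX r x) +o BX"
  unfolding BX_def rB_def
  by (rule tens2_add_left tens2_add_right tens2_balanced [where rA = "\<lambda>r b. zeta r * b" and lB = lX])+

lemma BBX_add_left: "frag_of (b + b', c, x) +o BBX = (frag_of (b, c, x) + frag_of (b', c, x)) +o BBX"
  and BBX_add_middle: "frag_of (b, c + c', x) +o BBX = (frag_of (b, c, x) + frag_of (b, c', x)) +o BBX"
  and BBX_add_right: "frag_of (b, c, x + y) +o BBX = (frag_of (b, c, x) + frag_of (b, c, y)) +o BBX"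
  unfolding BBX_def by (rule tens3_add_left tens3_add_middle tens3_add_right)+

lemma BBX_balanced_left: "frag_of (zeta r * b, c, x) +o BBX = frag_of (b, xi r * c, x) +o BBX"
  using tens3_balanced_left [of rB r b c x lB rB lX] by (simp add: BBX_def rB_def lB_def)

lemma BBX_balanced_right: "frag_of (b, zeta r * c, x) +o BBX = frag_of (b, c, lX r x) +o BBX"
  using tens3_balanced_right [of b rB r c x rB lB lX] by (simp add: BBX_def rB_def lB_def)

lemma descends_BX:
  assumes "is_subgroup N"
    and "\<And>a a' b. f (a + a', b) +o N = (f (a, b) + f (a', b)) +o N"
    and "\<And>a b b'. f (a, b + b') +o N = (f (a, b) + f (a, b')) +o N"
    and "\<And>r a b. f (zeta r * a, b) +o N = f (a, lX r b) +o N"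
  shows "descends BX N f"
  unfolding BX_def rB_def by (rule descends_tens2) (rule assms)+

lemma descends_val_BX:
  assumes "\<And>a a' b. f (a + a', b) = f (a, b) + f (a', b)"
    and "\<And>a b b'. f (a, b + b') = f (a, b) + f (a, b')"
    and "\<And>r a b. f (zeta r * a, b) = f (a, lX r b)"
  shows "descends_val BX f"
  unfolding BX_def rB_def by (rule descends_val_tens2) (rule assms)+

lemma descends_BBX:
  assumes "is_subgroup N"
    and "\<And>a a' b c. f (a + a', b, c) +o N = (f (a, b, c) + f (a', b, c)) +o N"
    and "\<And>a b b' c. f (a, b + b', c) +o N = (f (a, b, c) + f (a, b', c)) +o N"
    and "\<And>a b c c'. f (a, b, c + c') +o N = (f (a, b, c) + f (a, b, c')) +o N"
    and "\<And>r a b c. f (zeta r * a, b, c) +o N = f (a, xi r * b, c) +o N"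
    and "\<And>r a b c. f (a, zeta r * b, c) +o N = f (a, b, lX r c) +o N"
  shows "descends BBX N f"
  unfolding BBX_def rB_def lB_def by (rule descends_tens3) (rule assms)+

definition P :: "'x \<Rightarrow> ('b \<times> 'x \<Rightarrow>\<^sub>0 int)"
  where "P x = coset_rep BX (rho x)"

lemma P_coset: "P x +o BX = rho x"
  unfolding P_def by (rule coset_rep [OF rho_closed])

lemma induced_rho:
  "\<lbrakk>descends BX N g; is_subgroup N; \<And>a. f a = g a +o N\<rbrakk> \<Longrightarrow>
    induced N f (rho x) = frag_extend g (P x) +o N"
  using induced_coset [of BX N g f "P x"] by (simp add: P_coset)

lemma P_add: "P (x + y) +o BX = (P x + P y) +o BX"
  using rho_add [of x y] by (simp add: coset_add flip: P_coset)

lemma P_left: "P (lX r x) +o BX = frag_extend (\<lambda>(b, y). frag_of (xi r * b, y)) (P x) +o BX"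
proof -
  have "descends BX BX (\<lambda>(b, y). frag_of (xi r * b, y))"
  proof (rule descends_BX; (simp only: prod.case)?)
    fix s b y
    have "frag_of (zeta s * (xi r * b), y) +o BX = frag_of (xi r * b, lX s y) +o BX"
      by (rule BX_balanced)
    then show "frag_of (xi r * (zeta s * b), y) +o BX = frag_of (xi r * b, lX s y) +o BX"
      by (simp only: xi_zeta_commute flip: mult.assoc)
  qed (simp_all add: distrib_left BX_add_left BX_add_right)
  then have "induced BX (\<lambda>(b, y). pure BX (xi r * b, y)) (rho x) =
      frag_extend (\<lambda>(b, y). frag_of (xi r * b, y)) (P x) +o BX"
    by (rule induced_rho) (auto simp: pure_def)
  then show ?thesis
    using rho_left [of r x] by (simp add: lB_def P_coset)
qed

text \<open>Unnesting the two sides of the axiom requires their outer maps to be balanced. On the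
  left this is right linearity of \<open>Delta\<close>, on the right it is left linearity of
  \<open>rho\<close>.\<close>

lemma P_coassociative:
  "frag_extend (\<lambda>(b, y). frag_extend (\<lambda>(b1, b2). frag_of (b1, b2, y)) (D b)) (P x) +o BBX =
   frag_extend (\<lambda>(b, y). frag_extend (\<lambda>(b', y'). frag_of (b, b', y')) (P y)) (P x) +o BBX"
proof -
  have in1: "descends BB BBX (\<lambda>(b1, b2). frag_of (b1, b2, y))" for y
    by (rule descends_BB) (simp_all add: BBX_add_left BBX_add_middle BBX_balanced_left)
  have in2: "descends BX BBX (\<lambda>(b', y). frag_of (b, b', y))" for b
    by (rule descends_BX) (simp_all add: BBX_add_right BBX_add_middle BBX_balanced_right)
  note c1 = descends_coset [OF in1 subgroup_BB subgroup_BBX]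
  note c2 = descends_coset [OF in2 subgroup_BX subgroup_BBX]
  have "descends BX BBX (\<lambda>(b, y). frag_extend (\<lambda>(b1, b2). frag_of (b1, b2, y)) (D b))"
  proof (rule descends_BX; (simp only: prod.case)?)
    fix b x y
    show "frag_extend (\<lambda>(b1, b2). frag_of (b1, b2, x + y)) (D b) +o BBX =
        (frag_extend (\<lambda>(b1, b2). frag_of (b1, b2, x)) (D b) +
         frag_extend (\<lambda>(b1, b2). frag_of (b1, b2, y)) (D b)) +o BBX"
      unfolding frag_extend_add_fun [symmetric]
      by (rule frag_extend_coset_cong) (auto simp: BBX_add_right)
  next
    fix r b x
    have "frag_extend (\<lambda>(b1, b2). frag_of (b1, b2, x)) (D (zeta r * b)) +o BBX =
        frag_extend (\<lambda>(b1, b2). frag_of (b1, zeta r * b2, x)) (D b) +o BBX"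
      using c1 [OF D_right, of x r b] by (simp add: frag_extend_frag_extend split_def)
    also have "\<dots> = frag_extend (\<lambda>(b1, b2). frag_of (b1, b2, lX r x)) (D b) +o BBX"
      by (rule frag_extend_coset_cong) (auto simp: BBX_balanced_right)
    finally show "frag_extend (\<lambda>(b1, b2). frag_of (b1, b2, x)) (D (zeta r * b)) +o BBX =
        frag_extend (\<lambda>(b1, b2). frag_of (b1, b2, lX r x)) (D b) +o BBX" .
  qed (simp_all add: c1 [OF D_add] flip: frag_extend_add)
  moreover have "induced BBX (\<lambda>(b1, b2). pure BBX (b1, b2, y)) (Delta b) =
      frag_extend (\<lambda>(b1, b2). frag_of (b1, b2, y)) (D b) +o BBX" for b y
    by (rule induced_Delta [OF in1]) (auto simp: pure_def)
  ultimately have 1: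
    "induced BBX (\<lambda>(b, y). induced BBX (\<lambda>(b1, b2). pure BBX (b1, b2, y)) (Delta b)) (rho x) =
     frag_extend (\<lambda>(b, y). frag_extend (\<lambda>(b1, b2). frag_of (b1, b2, y)) (D b)) (P x) +o BBX"
    by (intro induced_rho) auto
  have "descends BX BBX (\<lambda>(b, y). frag_extend (\<lambda>(b', y'). frag_of (b, b', y')) (P y))"
  proof (rule descends_BX; (simp only: prod.case)?)
    fix b b' x
    show "frag_extend (\<lambda>(c, y). frag_of (b + b', c, y)) (P x) +o BBX =
        (frag_extend (\<lambda>(c, y). frag_of (b, c, y)) (P x) +
         frag_extend (\<lambda>(c, y). frag_of (b', c, y)) (P x)) +o BBX"
      unfolding frag_extend_add_fun [symmetric]
      by (rule frag_extend_coset_cong) (auto simp: BBX_add_left)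
  next
    fix r b x
    have "frag_extend (\<lambda>(c, y). frag_of (b, c, y)) (P (lX r x)) +o BBX =
        frag_extend (\<lambda>(c, y). frag_of (b, xi r * c, y)) (P x) +o BBX"
      using c2 [OF P_left, of b r x] by (simp add: frag_extend_frag_extend split_def)
    also have "\<dots> = frag_extend (\<lambda>(c, y). frag_of (zeta r * b, c, y)) (P x) +o BBX"
      by (rule frag_extend_coset_cong) (auto simp: BBX_balanced_left)
    finally show "frag_extend (\<lambda>(c, y). frag_of (zeta r * b, c, y)) (P x) +o BBX =
        frag_extend (\<lambda>(c, y). frag_of (b, c, y)) (P (lX r x)) +o BBX" by simp
  qed (simp_all add: c2 [OF P_add] flip: frag_extend_add)
  moreover have "induced BBX (\<lambda>(b', y). pure BBX (b, b', y)) (rho x) =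
      frag_extend (\<lambda>(b', y). frag_of (b, b', y)) (P x) +o BBX" for b x
    by (rule induced_rho [OF in2]) (auto simp: pure_def)
  ultimately have 2:
    "induced BBX (\<lambda>(b, y). induced BBX (\<lambda>(b', y'). pure BBX (b, b', y')) (rho y)) (rho x) =
     frag_extend (\<lambda>(b, y). frag_extend (\<lambda>(b', y'). frag_of (b, b', y')) (P y)) (P x) +o BBX"
    by (intro induced_rho) auto
  show ?thesis using rho_coassociative [of x] by (simp only: 1 2)
qed

text \<open>\<open>mult.assoc\<close> brings \<open>zeta s * b * xi r\<close> to this shape, which
  \<open>eps_right\<close>, written with \<open>rB\<close>, does not match.\<close>

lemma eps_zeta_mult: "eps (zeta s * (b * c)) = eps (b * c) * s"
  using eps_right [of s "b * c"] by (simp add: rB_def)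

lemma eps_xi_mult: "eps (xi s * (b * c)) = s * eps (b * c)"
  using eps_left [of s "b * c"] by (simp add: lB_def)

lemma right_act_descends_val: "descends_val BX (\<lambda>(b, y). lX (eps (b * xi r)) y)"
  by (rule descends_val_BX)
    (simp_all add: distrib_right eps_add X.act_add_left X.act_add_right X.act_act mult.assoc eps_zeta_mult)

abbreviation rX :: "'r \<Rightarrow> 'x \<Rightarrow> 'x"
  where "rX \<equiv> comodule_right xi eps lX rho"

lemma rX_eq: "rX r x = frag_val (\<lambda>(b, y). lX (eps (b * xi r)) y) (P x)"
  using induced_val_coset [OF right_act_descends_val, of r "P x"]
  by (simp add: comodule_right_def P_coset)

lemma P_counit: "frag_val (\<lambda>(b, y). lX (eps b) y) (P x) = x"
  using rX_eq [of 1 x] rho_counit [of x] by (simp add: map_one comodule_right_def)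

text \<open>
  The coaction of \<open>x \<cdot> r\<close> is \<open>\<xi>(\<epsilon>(x\<^bsub>[-2]\<^esub> \<xi>(r))) x\<^bsub>[-1]\<^esub> \<otimes> x\<^bsub>[0]\<^esub>\<close>; by coassociativity the first factor
  is the counit axiom for \<open>x\<^bsub>[-1]\<^esub> \<xi>(r)\<close>, because \<open>\<Delta>(b \<xi>(r)) = b\<^sub>1 \<xi>(r) \<otimes> b\<^sub>2\<close>.
\<close>

lemma P_right: "P (rX r x) +o BX = frag_extend (\<lambda>(b, y). frag_of (b * xi r, y)) (P x) +o BX"
proof -
  let ?Phi = "\<lambda>(b, b', y). frag_of (xi (eps (b * xi r)) * b', y)"
  have Phi: "descends BBX BX ?Phi"
  proof (rule descends_BBX; (simp only: prod.case)?)
    fix s b b' x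
    have "frag_of (zeta s * (xi (eps (b * xi r)) * b'), x) +o BX =
        frag_of (xi (eps (b * xi r)) * b', lX s x) +o BX"
      by (rule BX_balanced)
    then show "frag_of (xi (eps (b * xi r)) * (zeta s * b'), x) +o BX =
        frag_of (xi (eps (b * xi r)) * b', lX s x) +o BX"
      by (simp only: xi_zeta_commute [of "eps (b * xi r)"] flip: mult.assoc)
  qed (simp_all add: distrib_right distrib_left eps_add map_add map_mult BX_add_left BX_add_right
      eps_zeta_mult mult.assoc)
  \<comment> \<open>The element \<open>rX r x\<close> is itself a sum; \<open>P\<close> is moved
    through it by additivity modulo \<open>BX\<close>.\<close>
  have "P (rX r x) +o BX = frag_extend (\<lambda>(b, y). P (lX (eps (b * xi r)) y)) (P x) +o BX"
    unfolding rX_eq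
    using frag_extend_additive [where F = P, OF subgroup_BX P_add, of "\<lambda>(b, y). lX (eps (b * xi r)) y" "P x"]
    by (simp add: split_def)
  also have "\<dots> = frag_extend ?Phi
      (frag_extend (\<lambda>(b, y). frag_extend (\<lambda>(b', y'). frag_of (b, b', y')) (P y)) (P x)) +o BX"
    unfolding frag_extend_frag_extend
    by (rule frag_extend_coset_cong) (auto simp: P_left frag_extend_frag_extend split_def)
  also have "\<dots> = frag_extend ?Phi
      (frag_extend (\<lambda>(b, y). frag_extend (\<lambda>(b1, b2). frag_of (b1, b2, y)) (D b)) (P x)) +o BX"
    by (rule descends_coset [OF Phi _ _ P_coassociative [symmetric]]) auto
  also have "\<dots> = frag_extend (\<lambda>(b, y). frag_of (b * xi r, y)) (P x) +o BX"
    unfolding frag_extend_frag_extend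
  proof (rule frag_extend_coset_cong_pair; (simp only: prod.case)?)
    fix b y
    show "frag_extend ?Phi (frag_extend (\<lambda>(b1, b2). frag_of (b1, b2, y)) (D b)) +o BX =
        frag_of (b * xi r, y) +o BX"
      using frag_extend_additive [where F = "\<lambda>c. frag_of (c, y)", OF subgroup_BX BX_add_left,
          of "\<lambda>(b1, b2). xi (eps (b1 * xi r)) * b2" "D b"]
      by (simp add: D_counit_left_xi [unfolded split_def] frag_extend_frag_extend split_def)
  qed simp
  finally show ?thesis .
qed

text \<open>
  Here the right action of \<open>r\<close> on \<open>x\<^bsub>[0]\<^esub>\<close> contributes \<open>\<zeta>(\<epsilon>(b\<^sub>2 \<xi>(r))) b\<^sub>1\<close> for \<open>b = x\<^bsub>[-1]\<^esub>\<close>, and the Takeuchi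
  condition moves \<open>r\<close> to the first factor before the counit axiom applies.
\<close>

lemma P_right_zeta:
  "frag_extend (\<lambda>(b, y). frag_of (b, rX r y)) (P x) +o BX =
   frag_extend (\<lambda>(b, y). frag_of (b * zeta r, y)) (P x) +o BX"
proof -
  let ?Psi = "\<lambda>(b, b', y). frag_of (b, lX (eps (b' * xi r)) y)"
  have Psi: "descends BBX BX ?Psi"
    by (rule descends_BBX)
      (simp_all add: distrib_right eps_add X.act_add_left X.act_add_right BX_add_left BX_add_right
        BX_balanced eps_zeta_mult eps_xi_mult mult.assoc X.act_act)
  have "frag_extend (\<lambda>(b, y). frag_of (b, rX r y)) (P x) +o BX = frag_extend ?Psi
      (frag_extend (\<lambda>(b, y). frag_extend (\<lambda>(b', y'). frag_of (b, b', y')) (P y)) (P x)) +o BX"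
    unfolding frag_extend_frag_extend
  proof (rule frag_extend_coset_cong_pair; (simp only: prod.case)?)
    fix b y
    show "frag_of (b, rX r y) +o BX =
        frag_extend ?Psi (frag_extend (\<lambda>(b', y'). frag_of (b, b', y')) (P y)) +o BX"
      using frag_extend_additive [where F = "\<lambda>z. frag_of (b, z)", OF subgroup_BX BX_add_right,
          of "\<lambda>(b, y). lX (eps (b * xi r)) y" "P y"]
      by (simp add: rX_eq frag_extend_frag_extend split_def)
  qed simp
  also have "\<dots> = frag_extend ?Psi
      (frag_extend (\<lambda>(b, y). frag_extend (\<lambda>(b1, b2). frag_of (b1, b2, y)) (D b)) (P x)) +o BX"
    by (rule descends_coset [OF Psi _ _ P_coassociative [symmetric]]) auto
  also have "\<dots> = frag_extend (\<lambda>(b, y). frag_of (b * zeta r, y)) (P x) +o BX"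
    unfolding frag_extend_frag_extend
  proof (rule frag_extend_coset_cong_pair; (simp only: prod.case)?)
    fix b y
    have "frag_extend ?Psi (frag_extend (\<lambda>(b1, b2). frag_of (b1, b2, y)) (D b)) +o BX =
        frag_extend (\<lambda>a. frag_of (case a of (b1, b2) \<Rightarrow> zeta (eps (b2 * xi r)) * b1, y)) (D b) +o BX"
      unfolding frag_extend_frag_extend by (rule frag_extend_coset_cong_pair) (simp_all add: BX_balanced)
    also have "\<dots> = frag_of (b * zeta r, y) +o BX"
      using frag_extend_additive [where F = "\<lambda>c. frag_of (c, y)", OF subgroup_BX BX_add_left,
          of "\<lambda>(b1, b2). zeta (eps (b2 * xi r)) * b1" "D b"]
      by (simp add: D_counit_right_xi)
    finally show "frag_extend ?Psi (frag_extend (\<lambda>(b1, b2). frag_of (b1, b2, y)) (D b)) +o BX =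
        frag_of (b * zeta r, y) +o BX" .
  qed simp
  finally show ?thesis .
qed

text \<open>Associativity of the right action comes from \<open>P_right\<close>: evaluating the
  formula for the action of \<open>s\<close> on it yields \<open>b * xi r * xi s\<close>.
  Commutation with the left action comes from \<open>P_left\<close> in the same way.\<close>

lemma bimodule_rX: "bimodule scale_R lX rX"
proof (unfold_locales)
  fix r s k x y
  show "rX r (x + y) = rX r x + rX r y"
    using descends_val_coset [OF right_act_descends_val subgroup_BX P_add, of r x y]
    by (simp add: rX_eq frag_val_add)
  show "rX (r + s) x = rX r x + rX s x"
    unfolding rX_eq frag_val_add_fun [symmetric]
    by (rule frag_val_cong) (auto simp: map_add distrib_left eps_add X.act_add_left)
  show "rX s (rX r x) = rX (r * s) x"
    using descends_val_coset [OF right_act_descends_val subgroup_BX P_right, of s r x]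
    by (simp add: rX_eq [of s "rX r x"] rX_eq [of "r * s"] frag_val_frag_extend split_def map_mult mult.assoc)
  show "rX 1 x = x"
    by (simp add: rX_eq map_one P_counit)
  have lX_val: "lX r (frag_val f p) = frag_val (\<lambda>a. lX r (f a)) p" for r and f :: "'b \<times> 'x \<Rightarrow> 'x" and p
    by (rule additive_frag_val) (rule X.act_add_right)
  show "lX r (rX s x) = rX s (lX r x)"
    using descends_val_coset [OF right_act_descends_val subgroup_BX P_left, of s r x]
    by (simp add: rX_eq lX_val frag_val_frag_extend split_def eps_xi_mult X.act_act mult.assoc)
  \<comment> \<open>The element \<open>xi (scale_R k 1)\<close> is a scalar multiple of 1, so it
    commutes with \<open>b\<close>, and left linearity of \<open>eps\<close> extracts it. The counit
    axiom evaluates the rest.\<close>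
  have "eps (b * xi (scale_R k 1)) = scale_R k 1 * eps b" for b
    using eps_left [of "scale_R k 1" b]
    by (simp add: lB_def map_scale map_one B.scale_mult_left B.scale_mult_right)
  then have "rX (scale_R k 1) x = lX (scale_R k 1) (frag_val (\<lambda>(b, y). lX (eps b) y) (P x))"
    by (simp add: rX_eq lX_val split_def X.act_act)
  then show "lX (scale_R k 1) x = rX (scale_R k 1) x"
    by (simp add: P_counit)
qed

end

section \<open>The module algebra as an \<open>R\<close>-ring\<close>

context left_module_algebra
begin

definition phi :: "'r \<Rightarrow> 't"
  where "phi r = act (xi r) 1"

lemma act_mult_descends: "descends_val BB (\<lambda>(b1, b2). act b1 t * act b2 t')"
  by (rule descends_val_BB)
    (simp_all add: Tmod.act_add_left distrib_left distrib_right mult_balanced flip: Tmod.act_act)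

lemma act_mult_D: "act b (t * t') = frag_val (\<lambda>(b1, b2). act b1 t * act b2 t') (D b)"
  using induced_val_coset [OF act_mult_descends, of t t' "D b"]
  by (simp add: act_mult D_coset)

text \<open>The product rule for \<open>1 * t\<close> with the comultiplication of
  \<open>xi r\<close>, whose second factor is 1.\<close>

lemma act_xi: "act (xi r) t = phi r * t"
proof -
  have "act (xi r) (1 * t) = induced_val (\<lambda>(b1, b2). act b1 1 * act b2 t) (frag_of (xi r, 1) +o BB)"
    unfolding act_mult Delta_xi pure_def ..
  also have "\<dots> = phi r * t"
    by (subst induced_val_coset [OF act_mult_descends]) (simp_all add: phi_def Tmod.act_one)
  finally show ?thesis by simp
qed

text \<open>Mirror image of \<open>act_xi\<close>, with the product \<open>t * 1\<close>. Since
  \<open>eps (zeta r) = r\<close>, the axiom \<open>act_unit\<close> makes \<open>zeta r\<close> and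
  \<open>xi r\<close> agree on the unit of \<open>T\<close>.\<close>

lemma act_zeta: "act (zeta r) t = t * phi r"
proof -
  have "eps (zeta r) = r"
    using eps_right [of r 1] by (simp add: rB_def eps_one)
  then have 1: "act (zeta r) 1 = phi r"
    using act_unit [of "zeta r"] by (simp add: phi_def)
  have "act (zeta r) (t * 1) = induced_val (\<lambda>(b1, b2). act b1 t * act b2 1) (frag_of (1, zeta r) +o BB)"
    unfolding act_mult Delta_zeta pure_def ..
  also have "\<dots> = t * phi r"
    by (subst induced_val_coset [OF act_mult_descends]) (simp_all add: 1 Tmod.act_one)
  finally show ?thesis by simp
qed

lemma k_algebra_map_phi: "k_algebra_map scale_R scale_T phi"
proof (unfold_locales)
  fix k r s
  show "phi (r + s) = phi r + phi s"
    by (simp add: phi_def map_add Tmod.act_add_left)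
  show "phi (scale_R k r) = scale_T k (phi r)"
    by (simp add: phi_def map_scale act_scale_left)
  show "phi (r * s) = phi r * phi s"
    using act_xi [of r "phi s"] by (simp add: phi_def map_mult Tmod.act_act)
  show "phi 1 = 1"
    by (simp add: phi_def map_one Tmod.act_one)
qed

end

section \<open>The transposition map of a module algebra and a comodule\<close>

locale module_algebra_comodule = left_module_algebra + left_comodule
begin

text \<open>\<open>'d\<close> is the type of \<open>T\<close> and \<open>'e\<close> the type of
  \<open>X\<close>. As \<open>P x\<close> is a choice, \<open>W x t\<close> is one representative of
  the value of \<open>w\<close>.\<close>

definition W :: "'e \<Rightarrow> 'd \<Rightarrow> ('d \<times> 'e \<Rightarrow>\<^sub>0 int)"
  where "W x t = frag_extend (\<lambda>(b, y). frag_of (act b t, y)) (P x)"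

abbreviation TX :: "('d \<times> 'e \<Rightarrow>\<^sub>0 int) set"
  where "TX \<equiv> tens2 (\<lambda>r t. t * phi r) lX"

lemmas TX_add_left = tens2_add_left [where rA = "\<lambda>r t. t * phi r" and lB = lX]
  and TX_add_right = tens2_add_right [where rA = "\<lambda>r t. t * phi r" and lB = lX]
  and TX_balanced = tens2_balanced [where rA = "\<lambda>r t. t * phi r" and lB = lX]

lemma act_descends: "descends BX TX (\<lambda>(b, y). frag_of (act b t, y))"
  by (rule descends_BX)
    (simp_all add: Tmod.act_add_left TX_add_left TX_add_right act_zeta TX_balanced flip: Tmod.act_act)

lemma W_coset:
  "p +o BX = q +o BX \<Longrightarrow>
    frag_extend (\<lambda>(b, y). frag_of (act b t, y)) p +o TX = frag_extend (\<lambda>(b, y). frag_of (act b t, y)) q +o TX"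
  by (rule descends_coset [OF act_descends]) auto

lemma transposition_rep_W: "transposition_rep scale_R scale_T phi lX rX W"
proof (intro transposition_rep.intro k_algebra_map_phi bimodule_rX transposition_rep_axioms.intro)
  fix x y and t t' r
  show "W (x + y) t +o TX = (W x t + W y t) +o TX"
    using W_coset [OF P_add, of t x y] by (simp add: W_def frag_extend_add)
  show "W x (t + t') +o TX = (W x t + W x t') +o TX"
    unfolding W_def frag_extend_add_fun [symmetric]
    by (rule frag_extend_coset_cong) (auto simp: Tmod.act_add_right TX_add_left)
  show "W (rX r x) t +o TX = W x (phi r * t) +o TX"
    using W_coset [OF P_right, of t r x]
    by (simp add: W_def frag_extend_frag_extend split_def flip: act_xi Tmod.act_act)
  show "W (lX r x) t +o TX = frag_extend (\<lambda>(t', y). frag_of (phi r * t', y)) (W x t) +o TX"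
    using W_coset [OF P_left, of t r x]
    by (simp add: W_def frag_extend_frag_extend split_def flip: act_xi Tmod.act_act)
  show "W x (t * phi r) +o TX = frag_extend (\<lambda>(t', y). frag_of (t', rX r y)) (W x t) +o TX"
    using W_coset [OF P_right_zeta, of t r x]
    by (simp add: W_def frag_extend_frag_extend split_def flip: act_zeta Tmod.act_act)
  \<comment> \<open>By \<open>act_unit\<close>, \<open>b\<close> sends the unit to
    \<open>phi (eps b)\<close>. Balancing moves \<open>eps b\<close> to the second factor, where the
    sum is the counit axiom of \<open>rho\<close>.\<close>
  have "W x 1 +o TX = frag_extend (\<lambda>a. frag_of (1, case a of (b, y) \<Rightarrow> lX (eps b) y)) (P x) +o TX"
    unfolding W_def
  proof (rule frag_extend_coset_cong_pair; (simp only: prod.case)?)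
    fix b y
    show "frag_of (act b 1, y) +o TX = frag_of (1, lX (eps b) y) +o TX"
      using TX_balanced [of 1 "eps b" y] act_unit [of b] by (simp add: phi_def)
  qed simp
  also have "\<dots> = frag_of (1, x) +o TX"
    using frag_extend_additive [where F = "\<lambda>y. frag_of (1, y)" and N = TX, OF _ TX_add_right,
        of "\<lambda>(b, y). lX (eps b) y" "P x"]
    by (simp add: P_counit)
  finally show "W x 1 +o TX = frag_of (1, x) +o TX" .
  \<comment> \<open>Both sides of \<open>W_mult\<close> are the image under \<open>?Theta\<close> of
    a twofold coaction: the product rule comultiplies \<open>b\<close>, while applying
    \<open>W\<close> twice coacts again on \<open>y\<close>.\<close>
  let ?Theta = "\<lambda>(b1, b2, y). frag_of (act b1 t * act b2 t', y)"
  have Theta: "descends BBX TX ?Theta"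
    by (rule descends_BBX)
      (simp_all add: Tmod.act_add_left distrib_left distrib_right TX_add_left TX_add_right act_zeta act_xi
        mult.assoc TX_balanced [of "u * v" for u v, unfolded mult.assoc] flip: Tmod.act_act)
  have "W x (t * t') +o TX = frag_extend ?Theta
      (frag_extend (\<lambda>(b, y). frag_extend (\<lambda>(b1, b2). frag_of (b1, b2, y)) (D b)) (P x)) +o TX"
    unfolding W_def frag_extend_frag_extend
  proof (rule frag_extend_coset_cong_pair; (simp only: prod.case)?)
    fix b y
    show "frag_of (act b (t * t'), y) +o TX = frag_extend ?Theta (frag_extend (\<lambda>(b1, b2). frag_of (b1, b2, y)) (D b)) +o TX"
      using frag_extend_additive [where F = "\<lambda>c. frag_of (c, y)" and N = TX, OF _ TX_add_left,
          of "\<lambda>(b1, b2). act b1 t * act b2 t'" "D b"]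
      by (simp add: act_mult_D frag_extend_frag_extend split_def)
  qed simp
  also have "\<dots> = frag_extend ?Theta
      (frag_extend (\<lambda>(b, y). frag_extend (\<lambda>(b', y'). frag_of (b, b', y')) (P y)) (P x)) +o TX"
    by (rule descends_coset [OF Theta _ _ P_coassociative]) auto
  finally show "W x (t * t') +o TX =
      frag_extend (\<lambda>(s, y). frag_extend (\<lambda>(s', z). frag_of (s * s', z)) (W y t')) (W x t) +o TX"
    by (simp add: W_def frag_extend_frag_extend split_def)
qed

lemma induced_rho_W: "induced TX (\<lambda>(b, y). pure TX (act b t, y)) (rho x) = W x t +o TX"
  unfolding W_def by (rule induced_rho [OF act_descends]) (auto simp: pure_def)

lemma ex_transposition_map:
  "\<exists>w. (\<forall>x t. w (pure (tens2 rX (\<lambda>r t. phi r * t)) (x, t)) =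
      induced TX (\<lambda>(b, y). pure TX (act b t, y)) (rho x)) \<and>
    transposition_map scale_R scale_T phi lX rX w"
  using transposition_rep.w_map_pure [OF transposition_rep_W]
    transposition_rep.transposition_map_w_map [OF transposition_rep_W]
  by (auto simp: induced_rho_W)

text \<open>Identifies the Sweedler formula, evaluated directly in the cyclic tensor product, with
  the formula that passes through \<open>W\<close>.\<close>

lemma induced_rho_append:
  assumes "length ts = n"
  shows "induced (cyc_rel phi lX rX n) (\<lambda>(b, y). pure (cyc_rel phi lX rX n) (ts @ [act b t], y)) (rho x) =
    frag_extend (\<lambda>(s, y). frag_of (ts @ [s], y)) (W x t) +o cyc_rel phi lX rX n"
proof -
  have "descends BX (cyc_rel phi lX rX n) (\<lambda>(b, y). frag_of (ts @ [act b t], y))"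
    using assms
    by (intro descends_BX) (simp_all add: Tmod.act_add_left cyc_add cyc_add_right act_zeta
        cyc_balanced_end flip: Tmod.act_act)
  then have "induced (cyc_rel phi lX rX n) (\<lambda>(b, y). pure (cyc_rel phi lX rX n) (ts @ [act b t], y)) (rho x) =
      frag_extend (\<lambda>(b, y). frag_of (ts @ [act b t], y)) (P x) +o cyc_rel phi lX rX n"
    by (rule induced_rho) (auto simp: pure_def)
  then show ?thesis
    by (simp add: W_def frag_extend_frag_extend split_def)
qed

lemma ex_para_cocyclic_module:
  "\<exists>w. (\<forall>n t ts x. length ts = n \<longrightarrow> w n (pure (cyc_rel phi lX rX n) (t # ts, x)) =
      induced (cyc_rel phi lX rX n) (\<lambda>(b, y). pure (cyc_rel phi lX rX n) (ts @ [act b t], y)) (rho x)) \<and>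
    para_cocyclic_module (cyc_carrier phi lX rX) (cyc_scale scale_T phi lX rX)
      (cyc_coface phi lX rX) (cyc_codegeneracy phi lX rX) w"
  using transposition_rep.w_cyc_pure [OF transposition_rep_W]
    transposition_rep.para_cocyclic_module_cyc [OF transposition_rep_W]
  by (metis induced_rho_append)

end

theorem theorem2p4:
  fixes scale_R :: "'k::{comm_ring,comm_monoid_mult} \<Rightarrow> 'r::{ring,monoid_mult} \<Rightarrow> 'r"
    and scale_B :: "'k \<Rightarrow> 'b::{ring,monoid_mult} \<Rightarrow> 'b"
    and xi zeta :: "'r \<Rightarrow> 'b"
    and Delta :: "'b \<Rightarrow> ('b \<times> 'b \<Rightarrow>\<^sub>0 int) set"
    and eps :: "'b \<Rightarrow> 'r"
    and scale_T :: "'k \<Rightarrow> 't::{ring,monoid_mult} \<Rightarrow> 't"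
    and act :: "'b \<Rightarrow> 't \<Rightarrow> 't"
    and lX :: "'r \<Rightarrow> 'x::ab_group_add \<Rightarrow> 'x"
    and rho :: "'x \<Rightarrow> ('b \<times> 'x \<Rightarrow>\<^sub>0 int) set"
  assumes "left_bialgebroid scale_R scale_B xi zeta Delta eps"
    and "left_module_algebra scale_R scale_B xi zeta Delta eps scale_T act"
    and "left_comodule scale_R scale_B xi zeta Delta eps lX rho"
  shows "let phi = (\<lambda>r. act (xi r) 1);
             rX = comodule_right xi eps lX rho;
             XT = tens2 rX (\<lambda>r t. phi r * t);
             TX = tens2 (\<lambda>r t. t * phi r) lX;
             N = cyc_rel phi lX rX
         in (\<exists>w. (\<forall>x t. w (pure XT (x, t)) = induced TX (\<lambda>(b, y). pure TX (act b t, y)) (rho x))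
               \<and> transposition_map scale_R scale_T phi lX rX w)
          \<and> (\<exists>w. (\<forall>n t0 ts x. length ts = n \<longrightarrow>
                    w n (pure (N n) (t0 # ts, x)) =
                    induced (N n) (\<lambda>(b, y). pure (N n) (ts @ [act b t0], y)) (rho x))
               \<and> para_cocyclic_module (cyc_carrier phi lX rX) (cyc_scale scale_T phi lX rX)
                    (cyc_coface phi lX rX) (cyc_codegeneracy phi lX rX) w)"
proof -
  have M: "module_algebra_comodule scale_R scale_B xi zeta Delta eps scale_T act lX rho"
    using assms(2,3) by (rule module_algebra_comodule.intro)
  have phi: "left_module_algebra.phi xi act = (\<lambda>r. act (xi r) 1)"
    using left_module_algebra.phi_def [OF assms(2)] by blast
  show ?thesis
    using module_algebra_comodule.ex_transposition_map [OF M]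
      module_algebra_comodule.ex_para_cocyclic_module [OF M]
    unfolding phi Let_def by (rule conjI)
qed

end
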